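(* Let $\mathrm{M}$ be the submodule of $\mathbf{Z}^{(\mathcal{B})}$ consisting of those $\ell$ such that $\zeta(\ell)_{n,n}=0$ for all integers $n\geqslant 0$. Then $\mathrm{M}$ is the kernel of $\delta:\mathbf{Z}^{(\mathcal{B})}\to\mathbf{Z}^{(\mathcal{A})}$.
   Context: A composition is a finite sequence $\mathbf{a}=(a_1,\ldots,a_r)$ of positive integers ($r\geqslant 0$), of depth $r$ and weight $|\mathbf{a}|=\sum a_i$; it is admissible if $r=0$ or $a_1\geqslant 2$. $\mathcal{A}$ (resp. $\mathcal{A}_k$) is the set of admissible compositions (resp. of weight $k$). Binary word: $\mathbf{w}(\mathbf{a})=0^{a_1-1}1\cdots0^{a_r-1}1$. The dual of a word $\varepsilon_1\cdots\varepsilon_k$ is $\overline{\varepsilon_k}\cdots\overline{\varepsilon_1}$ ($\overline0=1,\overline1=0$); for admissible $\mathbf{a}$, $\overline{\mathbf{a}}$ is the admissible composition with word dual to $\mathbf{w}(\mathbf{a})$. $\mathcal{B}$ is $\mathcal{A}$ modulo $\mathbf{a}\sim\overline{\mathbf{a}}$, classes $[\mathbf{a}]$, $\mathcal{B}_k$ classes of weight $k$; $\mathbf{Z}^{(X)}$ is the free $\mathbf{Z}$-module on $X$. For a composition, $(a_1,\ldots,a_r)^{\rm init}=(a_1,\ldots,a_{r-1})$ ($\varnothing^{\rm init}=\varnothing$); for admissible $\mathbf{a}$, $\mathbf{a}^{\rm fin}$ is the dual of $(\overline{\mathbf{a}})^{\rm init}$ and $\mathbf{a}^{\rm mid}=(\mathbf{a}^{\rm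 fin})^{\rm init}$; extended $\mathbf{Z}$-linearly. $\delta$ is the unique $\mathbf{Z}$-linear map $\mathbf{Z}^{(\mathcal{B})}\to\mathbf{Z}^{(\mathcal{A})}$ with $\delta(\mathbf{Z}^{\mathcal{B}_k})\subset\mathbf{Z}^{\mathcal{A}_k}$ for all $k$, $\delta([\varnothing])=\varnothing$, and $\delta([\mathbf{a}])^{\rm init}=\delta([\mathbf{a}^{\rm init}])+\delta([\mathbf{a}^{\rm mid}])+\delta([\mathbf{a}^{\rm fin}])$ for all non-empty admissible $\mathbf{a}$. For non-empty admissible $\mathbf{a}$ and $n\geqslant0$, $\zeta(\mathbf{a})_{n,n}=\sum_{n_1>\cdots>n_r>n}\binom{n_1+n}{n}^{-1}n_1^{-a_1}\cdots n_r^{-a_r}$, and $\zeta(\varnothing)_{n,n}=\binom{2n}{n}^{-1}$; since $\zeta(\mathbf{a})_{n,n}=\zeta(\overline{\mathbf{a}})_{n,n}$, this defines a $\mathbf{Z}$-linear map $\ell\mapsto\zeta(\ell)_{n,n}$ on $\mathbf{Z}^{(\mathcal{B})}$. *)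

theory Defs
  imports "HOL-Analysis.Analysis" "HOL-Library.Poly_Mapping"
begin

section \<open>Admissible compositions\<close>

typedef acomp = "{a :: nat list. 0 \<notin> set a \<and> (a = [] \<or> hd a \<ge> 2)}"
  morphisms parts Acomp
  by (rule exI[of _ "[]"]) simp

setup_lifting type_definition_acomp

lift_definition empty_acomp :: acomp is "[]"
  by simp

lift_definition weight :: "acomp \<Rightarrow> nat" is sum_list .

lift_definition init :: "acomp \<Rightarrow> acomp" is butlast
proof -
  fix a :: "nat list"
  assume a: "0 \<notin> set a \<and> (a = [] \<or> hd a \<ge> 2)"
  have "butlast a = [] \<or> hd (butlast a) = hd a"
    by (cases a) auto
  with a show "0 \<notin> set (butlast a) \<and> (butlast a = [] \<or> hd (butlast a) \<ge> 2)"
    by (auto dest: in_set_butlastD)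
qed


section \<open>Binary words and duality\<close>

text \<open>The letters 0 and 1 are rendered as \<^term>\<open>False\<close> and \<^term>\<open>True\<close>.\<close>

definition list_word :: "nat list \<Rightarrow> bool list" where
  "list_word a = concat (map (\<lambda>m. replicate (m - 1) False @ [True]) a)"

definition word :: "acomp \<Rightarrow> bool list" where
  "word a = list_word (parts a)"

definition dual_word :: "bool list \<Rightarrow> bool list" where
  "dual_word w = rev (map Not w)"

text \<open>Existence and uniqueness of the described composition are \<open>word_dual\<close> and
  \<open>word_inject\<close> below.\<close>

definition dual :: "acomp \<Rightarrow> acomp" where
  "dual a = (THE b. word b = dual_word (word a))"

lemma list_word_Nil [simp]: "list_word [] = []"
  by (simp add: list_word_def)

lemma list_word_Cons [simp]:
  "list_word (m # a) = replicate (m - 1) False @ True # list_word a"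
  by (simp add: list_word_def)

lemma replicate_False_True_inject:
  "replicate m False @ True # u = replicate m' False @ True # u' \<longleftrightarrow> m = m' \<and> u = u'"
proof (induction m arbitrary: m')
  case 0
  show ?case by (cases m') auto
next
  case (Suc m)
  then show ?case by (cases m') auto
qed

lemma list_word_inject:
  assumes "0 \<notin> set a" "0 \<notin> set b" "list_word a = list_word b"
  shows "a = b"
  using assms
proof (induction a arbitrary: b)
  case Nil
  then show ?case by (cases b) auto
next
  case (Cons m a)
  then obtain m' b' where b: "b = m' # b'" by (cases b) auto
  have "m - 1 = m' - 1 \<and> list_word a = list_word b'"
    using Cons.prems(3) by (simp add: b replicate_False_True_inject)
  moreover from this have "a = b'"
    using Cons.IH[of b'] Cons.prems(1,2) by (simp add: b)
  moreover have "m \<noteq> 0" "m' \<noteq> 0" using Cons.prems(1,2) by (auto simp: b)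
  ultimately show ?case by (simp add: b)
qed

lemma list_word_surj:
  assumes "w = [] \<or> last w"
  shows "\<exists>a. 0 \<notin> set a \<and> list_word a = w"
  using assms
proof (induction w)
  case Nil
  show ?case by (rule exI[of _ "[]"]) simp
next
  case (Cons x w)
  show ?case
  proof (cases "w = []")
    case True
    with Cons show ?thesis by (intro exI[of _ "[1]"]) simp
  next
    case False
    with Cons obtain a where a: "0 \<notin> set a" "list_word a = w" by auto
    show ?thesis
    proof (cases x)
      case True
      with a show ?thesis by (intro exI[of _ "1 # a"]) simp
    next
      case xF: False
      from a False obtain m t where mt: "a = m # t" by (cases a) auto
      with a(1) obtain k where k: "m = Suc k" by (cases m) simp_all
      have "list_word (Suc m # t) = x # w"
        using a(2) xF by (simp add: mt k)
      moreover have "0 \<notin> set (Suc m # t)" using a(1) mt by simp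
      ultimately show ?thesis by blast
    qed
  qed
qed

lemma list_word_eq_Nil [simp]: "list_word a = [] \<longleftrightarrow> a = []"
  by (cases a) auto

lemma last_list_word: "a \<noteq> [] \<Longrightarrow> last (list_word a)"
  by (induction a) auto

lemma hd_list_word:
  assumes "a \<noteq> []" "0 \<notin> set a"
  shows "\<not> hd (list_word a) \<longleftrightarrow> hd a \<ge> 2"
proof -
  from assms obtain m t where a: "a = m # t" "m > 0" by (cases a) auto
  show ?thesis
  proof (cases "m = 1")
    case False
    with a obtain k where "m = Suc (Suc k)"
      by (metis One_nat_def Suc_pred neq0_conv)
    with a show ?thesis by simp
  qed (use a in simp)
qed

lemma length_list_word: "0 \<notin> set a \<Longrightarrow> length (list_word a) = sum_list a"
  by (induction a) auto

lemma parts_pos: "0 \<notin> set (parts a)"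
  using parts[of a] by simp

lemma word_inject: "word a = word b \<longleftrightarrow> a = b"
  by (metis list_word_inject parts_inject parts_pos word_def)

lemma word_range: "(\<exists>a. word a = w) \<longleftrightarrow> w = [] \<or> (\<not> hd w \<and> last w)"
proof
  assume "\<exists>a. word a = w"
  then obtain a where "word a = w" by blast
  then show "w = [] \<or> (\<not> hd w \<and> last w)"
    using parts[of a] hd_list_word[of "parts a"] last_list_word[of "parts a"]
    by (auto simp: word_def)
next
  assume w: "w = [] \<or> (\<not> hd w \<and> last w)"
  then obtain a where a: "0 \<notin> set a" "list_word a = w"
    using list_word_surj by blast
  with w have "a = [] \<or> hd a \<ge> 2" using hd_list_word[of a] by auto
  with a have "word (Acomp a) = w" by (simp add: word_def Acomp_inverse)
  then show "\<exists>a. word a = w" ..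
qed

lemma dual_word_dual_word [simp]: "dual_word (dual_word w) = w"
  by (simp add: dual_word_def rev_map o_def)

lemma word_dual: "word (dual a) = dual_word (word a)"
proof -
  have "word a = [] \<or> (\<not> hd (word a) \<and> last (word a))"
    using word_range by blast
  then have "dual_word (word a) = [] \<or> (\<not> hd (dual_word (word a)) \<and> last (dual_word (word a)))"
    by (auto simp: dual_word_def hd_rev last_rev last_map hd_map)
  then obtain b where "word b = dual_word (word a)"
    using word_range by blast
  then have "word (THE b. word b = dual_word (word a)) = dual_word (word a)"
    by (rule theI) (metis \<open>word b = dual_word (word a)\<close> word_inject)
  then show ?thesis by (simp add: dual_def)
qed

lemma dual_dual [simp]: "dual (dual a) = a"
  by (simp add: word_inject[symmetric] word_dual)

lemma weight_eq_length_word: "weight a = length (word a)"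
  by (simp add: weight.rep_eq word_def length_list_word parts_pos)

lemma weight_dual [simp]: "weight (dual a) = weight a"
  by (simp add: weight_eq_length_word word_dual dual_word_def)

definition fin :: "acomp \<Rightarrow> acomp" where
  "fin a = dual (init (dual a))"

definition mid :: "acomp \<Rightarrow> acomp" where
  "mid a = init (fin a)"

quotient_type bcomp = acomp / "\<lambda>a b. b = a \<or> b = dual a"
  morphisms rep_bcomp cls
proof (rule equivpI)
  show "symp (\<lambda>a b. b = a \<or> b = dual a)" by (rule sympI) (metis dual_dual)
  show "transp (\<lambda>a b. b = a \<or> b = dual a)" by (rule transpI) (metis dual_dual)
qed (simp add: reflp_def)

lemma cls_eq_iff: "cls a = cls b \<longleftrightarrow> b = a \<or> b = dual a"
  by (simp add: bcomp.abs_eq_iff)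

lemma cls_surj: "\<exists>a. b = cls a"
  by (metis Quotient3_abs_rep Quotient3_bcomp)


section \<open>The map \<open>\<delta>\<close>\<close>

text \<open>The free \<open>\<int>\<close>-module on a type \<open>'a\<close> is \<^typ>\<open>'a \<Rightarrow>\<^sub>0 int\<close>, with basis
  \<^term>\<open>frag_of\<close> and scalar multiplication \<^term>\<open>frag_cmul\<close>.\<close>

definition free_on :: "'a set \<Rightarrow> ('a \<Rightarrow>\<^sub>0 int) set" where
  "free_on X = {x. Poly_Mapping.keys x \<subseteq> X}"

definition A_wt :: "nat \<Rightarrow> acomp set" where
  "A_wt k = {a. weight a = k}"

definition B_wt :: "nat \<Rightarrow> bcomp set" where
  "B_wt k = cls ` A_wt k"

definition init_lin :: "(acomp \<Rightarrow>\<^sub>0 int) \<Rightarrow> (acomp \<Rightarrow>\<^sub>0 int)" where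
  "init_lin = frag_extend (\<lambda>a. frag_of (init a))"

definition is_delta :: "((bcomp \<Rightarrow>\<^sub>0 int) \<Rightarrow> (acomp \<Rightarrow>\<^sub>0 int)) \<Rightarrow> bool" where
  "is_delta d \<longleftrightarrow>
     module_hom frag_cmul frag_cmul d \<and>
     (\<forall>k. d ` free_on (B_wt k) \<subseteq> free_on (A_wt k)) \<and>
     d (frag_of (cls empty_acomp)) = frag_of empty_acomp \<and>
     (\<forall>a. a \<noteq> empty_acomp \<longrightarrow>
        init_lin (d (frag_of (cls a))) =
          d (frag_of (cls (init a))) + d (frag_of (cls (mid a))) + d (frag_of (cls (fin a))))"

text \<open>Existence and uniqueness are \<open>ex1_is_delta\<close> below.\<close>

definition delta :: "(bcomp \<Rightarrow>\<^sub>0 int) \<Rightarrow> (acomp \<Rightarrow>\<^sub>0 int)" where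
  "delta = (THE d. is_delta d)"

lemma parts_empty_acomp [simp]: "parts empty_acomp = []"
  by (rule empty_acomp.rep_eq)

lemma parts_eq_Nil [simp]: "parts a = [] \<longleftrightarrow> a = empty_acomp"
  by (metis parts_empty_acomp parts_inject)

lemma weight_eq_0 [simp]: "weight a = 0 \<longleftrightarrow> a = empty_acomp"
  by (simp add: weight_eq_length_word word_def)

lemma weight_empty_acomp [simp]: "weight empty_acomp = 0"
  by simp

lemma weight_ge_2: "a \<noteq> empty_acomp \<Longrightarrow> weight a \<ge> 2"
proof -
  assume "a \<noteq> empty_acomp"
  then have "parts a \<noteq> []" by simp
  then obtain m t where mt: "parts a = m # t" by (meson neq_Nil_conv)
  then have "m \<ge> 2" using parts[of a] by simp
  then show ?thesis by (simp add: weight.rep_eq mt)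
qed

lemma dual_empty_acomp [simp]: "dual empty_acomp = empty_acomp"
  by (metis weight_dual weight_eq_0)

lemma dual_eq_empty [simp]: "dual a = empty_acomp \<longleftrightarrow> a = empty_acomp"
  by (metis dual_dual dual_empty_acomp)

lemma parts_snoc: "a \<noteq> empty_acomp \<Longrightarrow> parts a = parts (init a) @ [last (parts a)]"
  by (simp add: init.rep_eq)

lemma weight_init_last: "a \<noteq> empty_acomp \<Longrightarrow> weight a = weight (init a) + last (parts a)"
  using arg_cong[OF parts_snoc, of a sum_list] by (simp add: weight.rep_eq)

lemma last_parts_pos: "a \<noteq> empty_acomp \<Longrightarrow> last (parts a) > 0"
  by (metis parts_pos last_in_set neq0_conv parts_eq_Nil)

lemma weight_init_less: "a \<noteq> empty_acomp \<Longrightarrow> weight (init a) < weight a"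
  using weight_init_last last_parts_pos by fastforce

lemma weight_init_le: "weight (init a) \<le> weight a"
proof (cases "a = empty_acomp")
  case True
  then have "parts (init a) = []" by (simp add: init.rep_eq)
  with True show ?thesis by simp
qed (use weight_init_less in fastforce)

lemma weight_fin_less: "a \<noteq> empty_acomp \<Longrightarrow> weight (fin a) < weight a"
  using weight_init_less[of "dual a"] by (simp add: fin_def)

lemma weight_mid_less: "a \<noteq> empty_acomp \<Longrightarrow> weight (mid a) < weight a"
  using weight_fin_less[of a] weight_init_le[of "fin a"] by (simp add: mid_def)

definition ext :: "nat \<Rightarrow> acomp \<Rightarrow> acomp" where
  "ext k c = Acomp (parts c @ [k - weight c])"

lemma parts_ext:
  assumes "k \<ge> 2" "weight c < k"
  shows "parts (ext k c) = parts c @ [k - weight c]"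
proof -
  have "hd (parts c @ [k - weight c]) \<ge> 2"
  proof (cases "c = empty_acomp")
    case True
    with assms show ?thesis by simp
  next
    case False
    then show ?thesis using parts[of c] by simp
  qed
  then show ?thesis using assms parts_pos[of c]
    by (simp add: ext_def Acomp_inverse)
qed

lemma init_ext: "k \<ge> 2 \<Longrightarrow> weight c < k \<Longrightarrow> init (ext k c) = c"
  by (simp add: init.rep_eq parts_ext flip: parts_inject)

lemma weight_ext: "k \<ge> 2 \<Longrightarrow> weight c < k \<Longrightarrow> weight (ext k c) = k"
  by (simp add: weight.rep_eq parts_ext)

lemma ext_init: "a \<noteq> empty_acomp \<Longrightarrow> ext (weight a) (init a) = a"
  by (metis ext_def parts_snoc weight_init_last add_diff_cancel_left' parts_inverse)

lemma frag_extend_id: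
  assumes "\<And>a. a \<in> Poly_Mapping.keys x \<Longrightarrow> f a = a"
  shows "frag_extend (\<lambda>a. frag_of (f a)) x = x"
proof -
  have "frag_extend (\<lambda>a. frag_of (f a)) x = frag_extend frag_of x"
    by (rule frag_extend_eq) (simp add: assms)
  then show ?thesis using frag_expansion[of x] by simp
qed

lemma frag_extend_frag_of_compose:
  "frag_extend (\<lambda>a. frag_of (f a)) (frag_extend (\<lambda>a. frag_of (g a)) x)
    = frag_extend (\<lambda>a. frag_of (f (g a))) x"
  using frag_extend_compose[of "\<lambda>a. frag_of (f a)" g x] by (simp add: o_def)

definition ext_lin :: "nat \<Rightarrow> (acomp \<Rightarrow>\<^sub>0 int) \<Rightarrow> (acomp \<Rightarrow>\<^sub>0 int)" where
  "ext_lin k = frag_extend (\<lambda>a. frag_of (ext k a))"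

lemma ext_lin_init_lin:
  assumes "x \<in> free_on (A_wt k)" "k \<noteq> 0"
  shows "ext_lin k (init_lin x) = x"
  unfolding ext_lin_def init_lin_def frag_extend_frag_of_compose
proof (rule frag_extend_id)
  fix a assume "a \<in> Poly_Mapping.keys x"
  then have wt: "weight a = k" using assms by (auto simp: free_on_def A_wt_def)
  then have "a \<noteq> empty_acomp" using assms weight_eq_0 by metis
  then show "ext k (init a) = a" using ext_init wt by blast
qed

lemma init_lin_ext_lin:
  assumes "k \<ge> 2" "x \<in> free_on {c. weight c < k}"
  shows "init_lin (ext_lin k x) = x"
  unfolding ext_lin_def init_lin_def frag_extend_frag_of_compose
  by (rule frag_extend_id) (use assms in \<open>auto simp: free_on_def intro!: init_ext\<close>)

lemma ext_lin_in_free: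
  assumes "k \<ge> 2" "x \<in> free_on {c. weight c < k}"
  shows "ext_lin k x \<in> free_on (A_wt k)"
  using assms keys_frag_extend[of "\<lambda>a. frag_of (ext k a)" x]
  by (fastforce simp: ext_lin_def free_on_def A_wt_def keys_frag_of weight_ext)

lemma module_frag_cmul: "module (frag_cmul :: int \<Rightarrow> ('a \<Rightarrow>\<^sub>0 int) \<Rightarrow> _)"
  by unfold_locales (simp_all add: frag_cmul_distrib frag_cmul_distrib2)

lemma module_hom_frag_extend: "module_hom frag_cmul frag_cmul (frag_extend f)"
  by (auto simp: module_hom_def module_hom_axioms_def module_frag_cmul
      frag_extend_add frag_extend_cmul)

lemma module_hom_eq_frag_extend:
  assumes "module_hom frag_cmul frag_cmul d"
  shows "d x = frag_extend (\<lambda>b. d (frag_of b)) x"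
proof -
  interpret d: module_hom frag_cmul frag_cmul d by fact
  have "Poly_Mapping.keys x \<subseteq> UNIV" by simp
  then show ?thesis
    by (induction x rule: frag_induction) (simp_all add: d.diff frag_extend_diff)
qed

function delta_acomp :: "acomp \<Rightarrow> (acomp \<Rightarrow>\<^sub>0 int)" where
  "delta_acomp a = (if a = empty_acomp then frag_of empty_acomp else
     ext_lin (weight a) (delta_acomp (init a) + delta_acomp (mid a) + delta_acomp (fin a)))"
  by auto
termination
  by (relation "Wellfounded.measure weight") (simp_all add: weight_init_less weight_mid_less weight_fin_less)

declare delta_acomp.simps [simp del]

lemma free_on_add: "x \<in> free_on X \<Longrightarrow> y \<in> free_on X \<Longrightarrow> x + y \<in> free_on X"
  using Poly_Mapping.keys_add[of x y] by (auto simp: free_on_def)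

lemma free_on_mono: "x \<in> free_on X \<Longrightarrow> X \<subseteq> Y \<Longrightarrow> x \<in> free_on Y"
  by (auto simp: free_on_def)

lemma delta_acomp_sum_in:
  assumes "\<And>b. weight b < weight a \<Longrightarrow> delta_acomp b \<in> free_on (A_wt (weight b))"
    and "a \<noteq> empty_acomp"
  shows "delta_acomp (init a) + delta_acomp (mid a) + delta_acomp (fin a)
           \<in> free_on {c. weight c < weight a}"
proof -
  have *: "delta_acomp b \<in> free_on {c. weight c < weight a}" if "weight b < weight a" for b
    by (rule free_on_mono[OF assms(1)[OF that]]) (use that in \<open>auto simp: A_wt_def\<close>)
  show ?thesis using assms(2)
    by (intro free_on_add * weight_init_less weight_mid_less weight_fin_less)
qed

lemma delta_acomp_in: "delta_acomp a \<in> free_on (A_wt (weight a))"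
proof (induction "weight a" arbitrary: a rule: less_induct)
  case less
  show ?case
  proof (cases "a = empty_acomp")
    case True
    have "weight empty_acomp = 0" by simp
    with True show ?thesis
      by (subst delta_acomp.simps) (simp add: free_on_def A_wt_def keys_frag_of)
  next
    case False
    show ?thesis
      by (subst delta_acomp.simps)
        (simp add: False ext_lin_in_free[OF weight_ge_2[OF False] delta_acomp_sum_in[OF less False]])
  qed
qed

lemma init_lin_delta_acomp:
  assumes "a \<noteq> empty_acomp"
  shows "init_lin (delta_acomp a) = delta_acomp (init a) + delta_acomp (mid a) + delta_acomp (fin a)"
  by (subst delta_acomp.simps)
    (simp add: assms init_lin_ext_lin[OF weight_ge_2[OF assms] delta_acomp_sum_in[OF delta_acomp_in assms]])

lemma list_word_append [simp]: "list_word (a @ b) = list_word a @ list_word b"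
  by (simp add: list_word_def)

lemma dropWhile_replicate_append:
  "P x \<Longrightarrow> dropWhile P (replicate n x @ w) = dropWhile P w"
  by (induction n) auto

lemma list_word_butlast:
  "list_word (butlast a) = rev (dropWhile Not (tl (rev (list_word a))))"
proof (cases a rule: rev_cases)
  case (snoc b m)
  have "dropWhile Not (rev (list_word b)) = rev (list_word b)"
  proof (cases "b = []")
    case False
    then have "hd (rev (list_word b))" using last_list_word[of b] by (simp add: hd_rev)
    then show ?thesis using False by (cases "rev (list_word b)") auto
  qed simp
  with snoc show ?thesis by (simp add: dropWhile_replicate_append)
qed simp

lemma dropWhile_rev_map_Not: "dropWhile Not (map Not w) = map Not (dropWhile id w)"
  by (induction w) auto

lemma word_fin: "word (fin a) = dropWhile id (tl (word a))"
proof -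
  have "word (init b) = rev (dropWhile Not (tl (rev (word b))))" for b
    by (simp add: word_def init.rep_eq list_word_butlast)
  then show ?thesis
    by (simp add: fin_def word_dual dual_word_def dropWhile_rev_map_Not rev_map o_def
        flip: map_tl)
qed

definition list_fin :: "nat list \<Rightarrow> nat list" where
  "list_fin a = (case a of [] \<Rightarrow> [] | m # t \<Rightarrow> if m \<ge> 3 then (m - 1) # t else dropWhile ((=) 1) t)"

lemma list_word_dropWhile:
  "0 \<notin> set t \<Longrightarrow> list_word (dropWhile ((=) 1) t) = dropWhile id (list_word t)"
proof (induction t)
  case (Cons x t)
  consider "x = 1" | k where "x = Suc (Suc k)"
    using Cons.prems by (cases x rule: nat.exhaust; cases "x - 1") auto
  then show ?case
  proof cases
    case 1
    have "0 \<notin> set t" using Cons.prems by simp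
    from Cons.IH[OF this] show ?thesis by (simp add: 1)
  next
    case 2
    then show ?thesis by simp
  qed
qed simp

lemma list_word_list_fin:
  assumes "0 \<notin> set a" "a = [] \<or> hd a \<ge> 2"
  shows "list_word (list_fin a) = dropWhile id (tl (list_word a))"
proof (cases a)
  case (Cons m t)
  have m: "m \<ge> 2" and t: "0 \<notin> set t" using assms unfolding Cons by simp_all
  show ?thesis
  proof (cases "m = 2")
    case True
    show ?thesis unfolding Cons True
      using list_word_dropWhile[OF t] by (simp add: list_fin_def)
  next
    case False
    define k where "k = m - 3"
    have k: "m = Suc (Suc (Suc k))" using m False by (simp add: k_def)
    show ?thesis unfolding Cons k by (simp add: list_fin_def)
  qed
qed (simp add: list_fin_def)

lemma list_fin_pos:
  assumes "0 \<notin> set a"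
  shows "0 \<notin> set (list_fin a)"
proof (cases a)
  case (Cons m t)
  have "0 \<notin> set t" using assms unfolding Cons by simp
  then have "0 \<notin> set (dropWhile ((=) 1) t)" by (blast dest: set_dropWhileD)
  with \<open>0 \<notin> set t\<close> show ?thesis unfolding Cons list_fin_def by simp
qed (simp add: list_fin_def)

lemma parts_fin: "parts (fin a) = list_fin (parts a)"
proof (rule list_word_inject)
  show "0 \<notin> set (list_fin (parts a))"
    by (rule list_fin_pos[OF parts_pos])
  have "parts a = [] \<or> hd (parts a) \<ge> 2" using parts[of a] by blast
  from list_word_list_fin[OF parts_pos this] word_fin[of a]
  show "list_word (parts (fin a)) = list_word (list_fin (parts a))"
    unfolding word_def by (rule trans[OF _ sym, rotated])
qed (rule parts_pos)

lemma butlast_dropWhile: "butlast (dropWhile P t) = dropWhile P (butlast t)"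
  by (induction t) auto

lemma fin_init: "fin (init a) = init (fin a)"
proof -
  have "list_fin (butlast t) = butlast (list_fin t)" for t
    by (cases t) (simp_all add: list_fin_def butlast_dropWhile)
  then show ?thesis by (simp add: parts_fin init.rep_eq flip: parts_inject)
qed

lemma delta_acomp_dual: "delta_acomp (dual a) = delta_acomp a"
proof (induction "weight a" arbitrary: a rule: less_induct)
  case less
  show ?case
  proof (cases "a = empty_acomp")
    case False
    have 1: "init (dual a) = dual (fin a)" "fin (dual a) = dual (init a)"
      by (simp_all add: fin_def)
    have 2: "mid (dual a) = dual (mid a)"
      by (simp add: mid_def 1 flip: fin_init[of a]) (simp add: fin_def)
    show ?thesis
      using less[OF weight_init_less[OF False]] less[OF weight_mid_less[OF False]]
        less[OF weight_fin_less[OF False]] False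
      by (subst (1 2) delta_acomp.simps) (simp add: 1 2 add_ac)
  qed simp
qed

definition delta_bcomp :: "bcomp \<Rightarrow> (acomp \<Rightarrow>\<^sub>0 int)" where
  "delta_bcomp b = delta_acomp (rep_bcomp b)"

lemma delta_bcomp_cls [simp]: "delta_bcomp (cls a) = delta_acomp a"
proof -
  have "cls (rep_bcomp (cls a)) = cls a"
    by (metis Quotient3_abs_rep Quotient3_bcomp)
  then show ?thesis
    unfolding delta_bcomp_def cls_eq_iff by (metis delta_acomp_dual)
qed

lemma is_delta_frag_extend: "is_delta (frag_extend delta_bcomp)"
  unfolding is_delta_def
proof (intro conjI allI impI)
  fix k
  show "frag_extend delta_bcomp ` free_on (B_wt k) \<subseteq> free_on (A_wt k)"
  proof clarify
    fix x assume x: "x \<in> free_on (B_wt k)"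
    have "Poly_Mapping.keys (delta_bcomp b) \<subseteq> A_wt k" if "b \<in> Poly_Mapping.keys x" for b
    proof -
      from that x obtain a where "b = cls a" "weight a = k"
        by (auto simp: free_on_def B_wt_def A_wt_def)
      then show ?thesis using delta_acomp_in[of a] by (simp add: free_on_def)
    qed
    then show "frag_extend delta_bcomp x \<in> free_on (A_wt k)"
      using keys_frag_extend[of delta_bcomp x] by (fastforce simp: free_on_def)
  qed
qed (simp_all add: module_hom_frag_extend init_lin_delta_acomp delta_acomp.simps[of empty_acomp])

lemma is_delta_cls:
  assumes "is_delta d"
  shows "d (frag_of (cls a)) = delta_acomp a"
proof (induction "weight a" arbitrary: a rule: less_induct)
  case less
  show ?case
  proof (cases "a = empty_acomp")
    case True
    with assms show ?thesis by (simp add: is_delta_def delta_acomp.simps[of empty_acomp])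
  next
    case False
    have "frag_of (cls a) \<in> free_on (B_wt (weight a))"
      by (simp add: free_on_def B_wt_def A_wt_def keys_frag_of)
    with assms have "d (frag_of (cls a)) \<in> free_on (A_wt (weight a))"
      unfolding is_delta_def by blast
    then have "d (frag_of (cls a)) = ext_lin (weight a) (init_lin (d (frag_of (cls a))))"
      using False by (simp add: ext_lin_init_lin)
    also have "init_lin (d (frag_of (cls a))) =
        delta_acomp (init a) + delta_acomp (mid a) + delta_acomp (fin a)"
      using assms False less weight_init_less weight_mid_less weight_fin_less
      by (simp add: is_delta_def)
    also have "ext_lin (weight a) \<dots> = delta_acomp a"
      using False by (subst (4) delta_acomp.simps) simp
    finally show ?thesis .
  qed
qed

lemma ex1_is_delta: "\<exists>!d. is_delta d"
proof (rule ex1I[where a = "frag_extend delta_bcomp"])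
  show "is_delta (frag_extend delta_bcomp)" by (rule is_delta_frag_extend)
next
  fix d assume d: "is_delta d"
  have "d (frag_of b) = delta_bcomp b" for b
  proof -
    obtain a where b: "b = cls a" using cls_surj by blast
    show ?thesis unfolding b delta_bcomp_cls by (rule is_delta_cls[OF d])
  qed
  then have eq: "(\<lambda>b. d (frag_of b)) = delta_bcomp" by blast
  have hom: "module_hom frag_cmul frag_cmul d" using d unfolding is_delta_def by blast
  have "d x = frag_extend delta_bcomp x" for x
    using module_hom_eq_frag_extend[OF hom, of x] unfolding eq .
  then show "d = frag_extend delta_bcomp" by blast
qed

lemma is_delta_delta: "is_delta delta"
  unfolding delta_def by (rule theI'[OF ex1_is_delta])


section \<open>The values \<open>\<zeta>(\<ell>)\<^sub>n\<^sub>,\<^sub>n\<close>\<close>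

definition zeta_nn :: "acomp \<Rightarrow> nat \<Rightarrow> real" where
  "zeta_nn a n =
     (if a = empty_acomp then 1 / real ((2 * n) choose n)
      else \<Sum>\<^sub>\<infinity>m | length m = length (parts a) \<and> sorted_wrt (>) m \<and> (\<forall>i \<in> set m. i > n).
        1 / real ((hd m + n) choose n) * (\<Prod>i<length m. 1 / real (m ! i) ^ (parts a ! i)))"

text \<open>The common value of \<^const>\<open>zeta_nn\<close> on the members of a class.\<close>

definition zeta_nn_cls :: "bcomp \<Rightarrow> nat \<Rightarrow> real" where
  "zeta_nn_cls b n = (THE x. \<forall>a. cls a = b \<longrightarrow> zeta_nn a n = x)"

definition zeta_nn_lin :: "(bcomp \<Rightarrow>\<^sub>0 int) \<Rightarrow> nat \<Rightarrow> real" where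
  "zeta_nn_lin l n =
     (\<Sum>b\<in>Poly_Mapping.keys l. real_of_int (Poly_Mapping.lookup l b) * zeta_nn_cls b n)"

end

theory Submission
  imports Defs "HOL-Computational_Algebra.Polynomial"
begin

text \<open>
  Subtracting consecutive double tails \<open>\<zeta>(a)\<^sub>p\<^sub>,\<^sub>q\<close> in \<open>p\<close> gives the double tail of \<^term>\<open>init a\<close>, and in
  \<open>q\<close> that of \<^term>\<open>fin a\<close>, times a power of \<open>1/p\<close> or \<open>1/q\<close> whose exponent is the weight
  difference. Along the diagonal this is the recursion defining \<^const>\<open>delta\<close>; hence
  \<open>\<zeta>(\<ell>)\<^sub>n\<^sub>,\<^sub>n\<close> is the image of \<open>\<delta>(\<ell>)\<close> under the linear map sending a composition to its nested sum
  over \<open>m\<^sub>1 > \<dots> > m\<^sub>r > n\<close>, weighted by the inverse central binomial coefficient of \<open>m\<^sub>1\<close>.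

  These nested sums are linearly independent over polynomials in \<open>n\<close>: comparing a relation
  with its shift eliminates a deepest term, and leaves a rational \<open>g\<close> for which
  \<open>g(x) - v(x) g(x - 1)\<close> is a nonzero combination of negative powers of \<open>x\<close>. This is excluded by
  looking at integer poles; admissibility is needed when \<open>v(x) = (4 x - 2) / x\<close> is the
  ratio of central binomial coefficients.
\<close>

section \<open>Iterated tail sums: convergence, decay and linearity\<close>

section \<open>Double tails\<close>

text \<open>The summation index is \<open>m = n + 1 + j\<close>, so it runs over all
  \<open>m > n\<close>. In \<open>fold tail_sum a u\<close> the first entry of \<open>a\<close> is
  applied first: it belongs to the largest index, which also carries the weight \<open>u\<close>,
  and the last entry belongs to the smallest.\<close>

definition tail_sum :: "nat \<Rightarrow> (nat \<Rightarrow> real) \<Rightarrow> nat \<Rightarrow> real" where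
  "tail_sum k u n = suminf (\<lambda>j. u (n + 1 + j) / real (n + 1 + j) ^ k)"

lemma tendsto_divide_Suc: "(\<lambda>n. C / (real n + 1)) \<longlonglongrightarrow> 0"
  using tendsto_mult_right_zero[OF LIMSEQ_inverse_real_of_nat, of C]
  by (simp add: divide_inverse add.commute)

text \<open>This rate is chosen because tail sums with exponent at least 1 preserve it with the same
  constant \<open>C\<close>, so it survives any number of iterations.\<close>

definition decays :: "real \<Rightarrow> (nat \<Rightarrow> real) \<Rightarrow> bool" where
  "decays C u \<longleftrightarrow> (\<forall>n. 0 \<le> u n \<and> u n \<le> C / (real n + 1))"

lemma sums_inverse_pronic: "(\<lambda>j. C / (real (n + 1 + j) * (real (n + 1 + j) + 1))) sums (C / (real n + 1))"
proof -
  have "(\<lambda>j. C / (real (n + j) + 1)) \<longlonglongrightarrow> 0"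
    using LIMSEQ_ignore_initial_segment[OF tendsto_divide_Suc, of C n] by (simp add: add.commute)
  from telescope_sums'[OF this]
  have "(\<lambda>j. C / (real (n + j) + 1) - C / (real (n + Suc j) + 1)) sums (C / (real n + 1))"
    by simp
  moreover have "C / (real (n + j) + 1) - C / (real (n + Suc j) + 1)
      = C / (real (n + 1 + j) * (real (n + 1 + j) + 1))" for j
    by (simp add: divide_simps) (simp add: algebra_simps)
  ultimately show ?thesis by simp
qed

text \<open>Comparison with the telescoping series of \<open>sums_inverse_pronic\<close>, whose tail
  is exactly \<open>C / (n + 1)\<close>.\<close>

lemma tail_sum_bound:
  assumes "\<And>m. m \<ge> 1 \<Longrightarrow> 0 \<le> u m \<and> u m / real m ^ k \<le> C / (real m * (real m + 1))"
  shows "summable (\<lambda>j. u (n + 1 + j) / real (n + 1 + j) ^ k)" "decays C (tail_sum k u)"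
proof -
  have *: "summable (\<lambda>j. u (n + 1 + j) / real (n + 1 + j) ^ k)" for n
  proof (rule summable_comparison_test'[OF sums_summable[OF sums_inverse_pronic[of C n]]])
    fix j show "norm (u (n + 1 + j) / real (n + 1 + j) ^ k)
        \<le> C / (real (n + 1 + j) * (real (n + 1 + j) + 1))"
      using assms[of "n + 1 + j"] by simp
  qed
  then show "summable (\<lambda>j. u (n + 1 + j) / real (n + 1 + j) ^ k)" .
  have "0 \<le> tail_sum k u n" for n
    unfolding tail_sum_def by (rule suminf_nonneg[OF *]) (use assms in \<open>auto intro!: divide_nonneg_nonneg\<close>)
  moreover have "tail_sum k u n \<le> C / (real n + 1)" for n
    unfolding tail_sum_def sums_unique[OF sums_inverse_pronic[of C n]]
    by (rule suminf_le[OF _ * sums_summable[OF sums_inverse_pronic]])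
      (rule conjunct2[OF assms], simp)
  ultimately show "decays C (tail_sum k u)" by (simp add: decays_def)
qed

lemma decays_term_bound:
  assumes "decays C u" "k \<ge> 1" "m \<ge> 1"
  shows "0 \<le> u m \<and> u m / real m ^ k \<le> C / (real m * (real m + 1))"
proof -
  have u: "0 \<le> u m" "u m \<le> C / (real m + 1)" using assms by (auto simp: decays_def)
  have "real m ^ 1 \<le> real m ^ k" using assms by (intro power_increasing) auto
  then have "u m / real m ^ k \<le> u m / real m"
    using u assms by (intro divide_left_mono) auto
  also have "\<dots> \<le> (C / (real m + 1)) / real m" by (intro divide_right_mono u) simp
  finally show ?thesis using u by (simp add: mult.commute)
qed

text \<open>Admissibility enters here: a weight that is merely bounded needs exponent at least 2,
  and then \<open>m + 1 \<le> 2 * m\<close> gives the constant 2.\<close>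

lemma bounded_term_bound:
  assumes "\<And>n. 0 \<le> u n \<and> u n \<le> 1" "k \<ge> 2" "m \<ge> 1"
  shows "0 \<le> u m \<and> u m / real m ^ k \<le> 2 / (real m * (real m + 1))"
proof -
  have "real m ^ 2 \<le> real m ^ k" using assms by (intro power_increasing) auto
  then have "u m / real m ^ k \<le> 1 / real m ^ 2"
    using assms by (intro frac_le) auto
  also have "\<dots> \<le> 2 / (real m * (real m + 1))"
    using assms(3) by (simp add: divide_simps power2_eq_square)
  finally show ?thesis using assms by simp
qed

lemma decays_summable_tail:
  assumes "decays C u" "k \<ge> 1"
  shows "summable (\<lambda>j. u (n + 1 + j) / real (n + 1 + j) ^ k)"
  using assms by (intro tail_sum_bound(1) decays_term_bound)

lemma decays_tail_sum:
  assumes "decays C u" "k \<ge> 1"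
  shows "decays C (tail_sum k u)"
  using assms by (intro tail_sum_bound(2) decays_term_bound)

lemma decays_fold:
  assumes "decays C u" "0 \<notin> set a"
  shows "decays C (fold tail_sum a u)"
  using assms
proof (induction a arbitrary: u)
  case (Cons k a)
  then have "k \<ge> 1" by (cases k) auto
  with Cons have "decays C (tail_sum k u)" by (intro decays_tail_sum)
  with Cons show ?case by simp
qed simp

lemma decays_tendsto: "decays C u \<Longrightarrow> u \<longlonglongrightarrow> 0"
proof (rule tendsto_sandwich[of "\<lambda>_. 0" _ _ "\<lambda>n. C / (real n + 1)"])
  show "(\<lambda>n. C / (real n + 1)) \<longlonglongrightarrow> 0" by (rule tendsto_divide_Suc)
qed (auto simp: decays_def)

lemma decays_fold_bounded:
  assumes "\<And>n. 0 \<le> w n \<and> w n \<le> 1" "0 \<notin> set a" "a \<noteq> []" "hd a \<ge> 2"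
  shows "decays 2 (fold tail_sum a w)"
proof (cases a)
  case (Cons k t)
  have "decays 2 (tail_sum k w)"
    using assms Cons by (intro tail_sum_bound(2) bounded_term_bound) auto
  then show ?thesis using assms Cons by (auto intro: decays_fold)
qed (use assms in simp)

lemma summable_tail_fold:
  assumes "\<And>n. 0 \<le> w n \<and> w n \<le> 1" "0 \<notin> set (a @ [k])" "hd (a @ [k]) \<ge> 2"
  shows "summable (\<lambda>j. fold tail_sum a w (n + 1 + j) / real (n + 1 + j) ^ k)"
proof (cases "a = []")
  case True
  show ?thesis
    by (rule tail_sum_bound, rule bounded_term_bound) (use True assms in auto)
next
  case False
  have "k \<ge> 1" using assms(2) by (cases k) auto
  have "decays 2 (fold tail_sum a w)"
    using assms False by (intro decays_fold_bounded) auto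
  with \<open>k \<ge> 1\<close> show ?thesis by (intro decays_summable_tail)
qed

lemma tail_sum_Suc:
  assumes "summable (\<lambda>j. u (n + 1 + j) / real (n + 1 + j) ^ k)"
  shows "tail_sum k u n = tail_sum k u (Suc n) + u (Suc n) / real (Suc n) ^ k"
  using suminf_split_head[OF assms] by (simp add: tail_sum_def algebra_simps)

text \<open>The sum splits according to whether the smallest index equals \<open>n + 1\<close>; if
  it does, that index contributes the power with exponent \<open>last a\<close>, and the others form
  a nested sum for \<open>butlast a\<close>.\<close>

lemma fold_tail_sum_rec:
  assumes "\<And>n. 0 \<le> w n \<and> w n \<le> 1" "0 \<notin> set a" "a \<noteq> []" "hd a \<ge> 2"
  shows "fold tail_sum a w n = fold tail_sum a w (Suc n)
    + fold tail_sum (butlast a) w (Suc n) / real (Suc n) ^ last a"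
proof (cases a rule: rev_cases)
  case (snoc b k)
  have "summable (\<lambda>j. fold tail_sum b w (n + 1 + j) / real (n + 1 + j) ^ k)"
    using assms snoc by (intro summable_tail_fold) auto
  from tail_sum_Suc[OF this] show ?thesis by (simp add: snoc)
qed (use assms in simp)

lemma tail_sum_linear:
  assumes "decays C u" "decays D v" "k \<ge> 1"
  shows "tail_sum k (\<lambda>n. u n + c * v n) = (\<lambda>n. tail_sum k u n + c * tail_sum k v n)"
proof
  fix n
  have 1: "summable (\<lambda>j. u (n + 1 + j) / real (n + 1 + j) ^ k)"
    using assms by (intro decays_summable_tail)
  have 2: "summable (\<lambda>j. v (n + 1 + j) / real (n + 1 + j) ^ k)"
    using assms by (intro decays_summable_tail)
  show "tail_sum k (\<lambda>n. u n + c * v n) n = tail_sum k u n + c * tail_sum k v n"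
    unfolding tail_sum_def suminf_mult[OF 2, symmetric]
    by (subst suminf_add[OF 1 summable_mult[OF 2]]) (simp add: add_divide_distrib)
qed

lemma fold_tail_sum_linear:
  assumes "decays C u" "decays D v" "0 \<notin> set a"
  shows "fold tail_sum a (\<lambda>n. u n + c * v n) = (\<lambda>n. fold tail_sum a u n + c * fold tail_sum a v n)"
  using assms
proof (induction a arbitrary: u v)
  case (Cons k a)
  then have k: "k \<ge> 1" by (cases k) auto
  with Cons.prems have "decays C (tail_sum k u)" "decays D (tail_sum k v)"
    by (auto intro!: decays_tail_sum)
  with Cons show ?case by (simp add: tail_sum_linear[OF _ _ k])
qed simp

lemma fold_tail_sum_cmult:
  assumes "decays C u" "0 \<notin> set a"
  shows "fold tail_sum a (\<lambda>n. c * u n) = (\<lambda>n. c * fold tail_sum a u n)"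
  \<comment> \<open>The multiple \<open>c * u\<close> is read as
    \<open>u + (c - 1) * u\<close>.\<close>
  using fold_tail_sum_linear[OF assms(1,1,2), of "c - 1"]
  by (simp add: algebra_simps)

section \<open>Inverse binomial weights and the recursion in the second parameter\<close>

definition inv_binom :: "nat \<Rightarrow> nat \<Rightarrow> real" where
  "inv_binom q n = 1 / real ((n + q) choose q)"

lemma inv_binom_bounds: "0 \<le> inv_binom q n \<and> inv_binom q n \<le> 1"
  by (simp add: inv_binom_def divide_simps Suc_le_eq)

text \<open>At index 0 the weight is constantly 1, but from index 1 on it decays. Hence sums
  weighted by \<open>inv_binom (Suc q)\<close> converge even when the first exponent is 1.\<close>

lemma decays_inv_binom: "decays 1 (inv_binom (Suc q))"
  unfolding decays_def
proof
  fix n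
  have "n + 1 \<le> (n + Suc q) choose Suc q"
  proof (induction q)
    case (Suc q)
    have "(n + Suc (Suc q)) choose Suc (Suc q) = ((n + Suc q) choose Suc q) + ((n + Suc q) choose Suc (Suc q))"
      by simp
    with Suc show ?case by linarith
  qed simp
  then have "real n + 1 \<le> real ((n + Suc q) choose Suc q)" by linarith
  then show "0 \<le> inv_binom (Suc q) n \<and> inv_binom (Suc q) n \<le> 1 / (real n + 1)"
    by (auto simp: inv_binom_def intro!: divide_left_mono)
qed

lemma inv_binom_rec_q: "inv_binom q n = inv_binom (Suc q) n + real n / real (Suc q) * inv_binom (Suc q) n"
proof -
  have "Suc q * ((n + Suc q) choose Suc q) = (n + Suc q) * ((n + q) choose q)"
    using Suc_times_binomial_eq[of "n + q" q] by (simp add: mult.commute)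
  then have "real (Suc q) * real ((n + Suc q) choose Suc q) = real (n + Suc q) * real ((n + q) choose q)"
    by (metis of_nat_mult)
  moreover have "real ((n + Suc q) choose Suc q) > 0" "real ((n + q) choose q) > 0"
    by (simp_all del: binomial_Suc_Suc)
  ultimately show ?thesis
    by (simp add: inv_binom_def divide_simps del: binomial_Suc_Suc add_Suc_right)
      (simp add: algebra_simps del: binomial_Suc_Suc add_Suc_right)
qed

lemma inv_binom_commute: "inv_binom q n = inv_binom n q"
  by (simp add: inv_binom_def add.commute binomial_symmetric[of q "n + q"])

text \<open>This is \<open>inv_binom_rec_q\<close> with the two arguments exchanged by
  symmetry.\<close>

lemma inv_binom_telescope:
  "inv_binom (Suc q) (Suc n) / real (Suc n) =
    (inv_binom (Suc q) n - inv_binom (Suc q) (Suc n)) / real (Suc q)"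
  using inv_binom_rec_q[of n "Suc q"] by (simp add: inv_binom_commute[of "Suc q"])

text \<open>Summing with exponent 1 reproduces the weight up to the factor
  \<open>1 / (q + 1)\<close>, so a leading entry 1 can be removed at the cost of one such
  factor.\<close>

lemma tail_sum_one_inv_binom: "tail_sum 1 (inv_binom (Suc q)) = (\<lambda>n. 1 / real (Suc q) * inv_binom (Suc q) n)"
proof
  fix n
  have "(\<lambda>j. inv_binom (Suc q) (n + j)) \<longlonglongrightarrow> 0"
    using LIMSEQ_ignore_initial_segment[OF decays_tendsto[OF decays_inv_binom], of q n]
    by (simp add: add.commute)
  from telescope_sums'[OF this] have "(\<lambda>j. (inv_binom (Suc q) (n + j) - inv_binom (Suc q) (n + Suc j)) / real (Suc q))
      sums (inv_binom (Suc q) n / real (Suc q))"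
    by (intro sums_divide) simp
  moreover have "(inv_binom (Suc q) (n + j) - inv_binom (Suc q) (n + Suc j)) / real (Suc q)
      = inv_binom (Suc q) (n + 1 + j) / real (n + 1 + j) ^ 1" for j
    using inv_binom_telescope[of q "n + j"] by simp
  ultimately show "tail_sum 1 (inv_binom (Suc q)) n = 1 / real (Suc q) * inv_binom (Suc q) n"
    unfolding tail_sum_def by (simp add: sums_iff)
qed

text \<open>The factor \<open>n\<close> in \<open>inv_binom_rec_q\<close> cancels one power of the
  summation index and so lowers the exponent by one.\<close>

lemma tail_sum_inv_binom:
  assumes "k \<ge> 1"
  shows "tail_sum (Suc k) (inv_binom q) =
    (\<lambda>n. tail_sum (Suc k) (inv_binom (Suc q)) n + 1 / real (Suc q) * tail_sum k (inv_binom (Suc q)) n)"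
proof
  fix n
  let ?w = "inv_binom (Suc q)"
  have 1: "summable (\<lambda>j. ?w (n + 1 + j) / real (n + 1 + j) ^ Suc k)"
    by (rule decays_summable_tail[OF decays_inv_binom]) simp
  have 2: "summable (\<lambda>j. ?w (n + 1 + j) / real (n + 1 + j) ^ k)"
    by (rule decays_summable_tail[OF decays_inv_binom assms])
  have *: "inv_binom q m / real m ^ Suc k = ?w m / real m ^ Suc k + 1 / real (Suc q) * (?w m / real m ^ k)"
    if "m \<ge> 1" for m
    using that by (subst inv_binom_rec_q) (simp add: add_divide_distrib)
  show "tail_sum (Suc k) (inv_binom q) n = tail_sum (Suc k) ?w n + 1 / real (Suc q) * tail_sum k ?w n"
    unfolding tail_sum_def suminf_mult[OF 2, symmetric] suminf_add[OF 1 summable_mult[OF 2]]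
    by (subst *) simp_all
qed

lemma fold_tail_sum_ones:
  assumes "0 \<notin> set t"
  shows "fold tail_sum t (inv_binom (Suc q)) p =
    fold tail_sum (dropWhile ((=) 1) t) (inv_binom (Suc q)) p
      / real (Suc q) ^ (sum_list t - sum_list (dropWhile ((=) 1) t))"
  using assms
proof (induction t)
  case (Cons k t)
  show ?case
  proof (cases "k = 1")
    case True
    have le: "sum_list (dropWhile ((=) 1) t) \<le> sum_list t"
      by (induction t) auto
    have "fold tail_sum (k # t) (inv_binom (Suc q)) p = 1 / real (Suc q) * fold tail_sum t (inv_binom (Suc q)) p"
      using fold_tail_sum_cmult[OF decays_inv_binom, of t "1 / real (Suc q)" q] Cons.prems
        tail_sum_one_inv_binom[of q] True by simp
    also have "\<dots> = fold tail_sum (dropWhile ((=) 1) t) (inv_binom (Suc q)) p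
      / real (Suc q) ^ Suc (sum_list t - sum_list (dropWhile ((=) 1) t))"
      using Cons by simp
    also have "Suc (sum_list t - sum_list (dropWhile ((=) 1) t)) = sum_list (k # t) - sum_list (dropWhile ((=) 1) (k # t))"
      using le True by simp
    finally show ?thesis using True by simp
  qed simp
qed simp

text \<open>Raising \<open>q\<close> lowers the first entry by one. If it becomes 1, it is absorbed
  together with all ones that follow it, which is precisely the effect of \<open>list_fin\<close>;
  each unit of weight lost yields one factor \<open>1 / (q + 1)\<close>.\<close>

lemma fold_tail_sum_rec_fin:
  assumes "0 \<notin> set a" "a \<noteq> []" "hd a \<ge> 2"
  shows "fold tail_sum a (inv_binom q) p = fold tail_sum a (inv_binom (Suc q)) p
    + fold tail_sum (list_fin a) (inv_binom (Suc q)) p / real (Suc q) ^ (sum_list a - sum_list (list_fin a))"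
proof -
  obtain k t where a: "a = Suc k # t" and k: "k \<ge> 1"
    using assms by (cases a; cases "hd a") auto
  have t: "0 \<notin> set t" using assms a by simp
  let ?w = "inv_binom (Suc q)"
  have dec: "decays 1 (tail_sum k ?w)" "decays 1 (tail_sum (Suc k) ?w)"
    using k by (auto intro!: decays_tail_sum decays_inv_binom)
  have "fold tail_sum a (inv_binom q) p = fold tail_sum a ?w p + 1 / real (Suc q) * fold tail_sum (k # t) ?w p"
  proof -
    have "fold tail_sum a (inv_binom q) = fold tail_sum t (\<lambda>n. tail_sum (Suc k) ?w n + 1 / real (Suc q) * tail_sum k ?w n)"
      unfolding a fold.simps o_apply by (subst tail_sum_inv_binom[OF k]) (rule refl)
    also have "\<dots> = (\<lambda>n. fold tail_sum t (tail_sum (Suc k) ?w) n + 1 / real (Suc q) * fold tail_sum t (tail_sum k ?w) n)"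
      by (rule fold_tail_sum_linear[OF dec(2,1) t])
    finally show ?thesis by (simp add: a)
  qed
  also have "1 / real (Suc q) * fold tail_sum (k # t) ?w p =
      fold tail_sum (list_fin a) ?w p / real (Suc q) ^ (sum_list a - sum_list (list_fin a))"
  proof (cases "k = 1")
    case False
    then show ?thesis using k by (simp add: a list_fin_def)
  next
    \<comment> \<open>The outer factor, which comes from lowering the first entry from 2 to 1,
      accounts for the \<open>Suc\<close> in the exponent.\<close>
    case True
    have le: "sum_list (dropWhile ((=) 1) (k # t)) \<le> sum_list (k # t)"
      unfolding True by (induction t) auto
    have "1 / real (Suc q) * fold tail_sum (k # t) ?w p =
      fold tail_sum (dropWhile ((=) 1) (k # t)) ?w p
      / real (Suc q) ^ Suc (sum_list (k # t) - sum_list (dropWhile ((=) 1) (k # t)))"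
      using k t by (subst fold_tail_sum_ones) auto
    also have "Suc (sum_list (k # t) - sum_list (dropWhile ((=) 1) (k # t))) = sum_list a - sum_list (list_fin a)"
      using le True by (simp add: a list_fin_def)
    also have "dropWhile ((=) 1) (k # t) = list_fin a"
      using True by (simp add: a list_fin_def)
    finally show ?thesis .
  qed
  finally show ?thesis .
qed


section \<open>Iterated tails as sums over decreasing tuples\<close>

section \<open>Tails along the diagonal\<close>

lemma snoc_in_decreasing_iff:
  "length (m @ [j]) = Suc r \<and> sorted_wrt (>) (m @ [j]) \<and> (\<forall>i \<in> set (m @ [j]). i > n) \<longleftrightarrow>
    j > n \<and> (length m = r \<and> sorted_wrt (>) m \<and> (\<forall>i \<in> set m. i > j))" for j n :: nat
  by (auto simp: sorted_wrt_append)

lemma has_sum_tail_sum: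
  assumes "\<And>m. 0 \<le> u m" "summable (\<lambda>j. u (n + 1 + j) / real (n + 1 + j) ^ k)"
  shows "((\<lambda>j. u j / real j ^ k) has_sum tail_sum k u n) {n<..}"
proof -
  have "((\<lambda>j. u (n + 1 + j) / real (n + 1 + j) ^ k) has_sum tail_sum k u n) UNIV"
    unfolding tail_sum_def
    by (rule sums_nonneg_imp_has_sum[OF summable_sums[OF assms(2)]]) (use assms(1) in simp)
  then show ?thesis
    by (rule iffD1[OF has_sum_reindex_bij_witness[of _ "\<lambda>j. j - (n + 1)" "\<lambda>j. n + 1 + j"], rotated -1])
      auto
qed

text \<open>Tonelli: nonnegativity turns iterated summability into absolute summability over the
  whole set, and Fubini together with uniqueness of sums then identifies the value.\<close>

lemma has_sum_SigmaI_nonneg: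
  fixes f :: "'a \<Rightarrow> 'b \<Rightarrow> real"
  assumes g: "\<And>x. x \<in> A \<Longrightarrow> (f x has_sum g x) (B x)" and S: "(g has_sum S) A"
    and nonneg: "\<And>x y. x \<in> A \<Longrightarrow> y \<in> B x \<Longrightarrow> 0 \<le> f x y"
  shows "((\<lambda>(x, y). f x y) has_sum S) (Sigma A B)"
proof -
  have "(\<lambda>p. norm (case p of (x, y) \<Rightarrow> f x y)) summable_on Sigma A B"
    unfolding Infinite_Sum.abs_summable_on_Sigma_iff
  proof (intro conjI ballI)
    fix x assume x: "x \<in> A"
    have "f x summable_on B x" using g[OF x] by (auto simp: summable_on_def)
    then show "(\<lambda>y. norm (case (x, y) of (x, y) \<Rightarrow> f x y)) summable_on B x"
      using nonneg[OF x] by (simp cong: summable_on_cong)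
  next
    have "(\<lambda>x. norm (infsum (\<lambda>y. norm (f x y)) (B x))) summable_on A \<longleftrightarrow> g summable_on A"
    proof (rule summable_on_cong)
      fix x assume x: "x \<in> A"
      have "infsum (\<lambda>y. norm (f x y)) (B x) = infsum (f x) (B x)"
        using nonneg[OF x] by (intro infsum_cong) simp
      also have "\<dots> = g x" by (rule infsumI[OF g[OF x]])
      moreover have "0 \<le> g x" using has_sum_nonneg[OF g[OF x]] nonneg[OF x] by blast
      ultimately show "norm (infsum (\<lambda>y. norm (f x y)) (B x)) = g x" by simp
    qed
    with S show "(\<lambda>x. norm (infsum (\<lambda>y. norm (case (x, y) of (x, y) \<Rightarrow> f x y)) (B x))) summable_on A"
      by (auto simp: summable_on_def)
  qed
  then have "(\<lambda>(x, y). f x y) summable_on Sigma A B" by (rule abs_summable_summable)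
  then obtain S' where S': "((\<lambda>(x, y). f x y) has_sum S') (Sigma A B)" by (auto simp: summable_on_def)
  have "(g has_sum S') A" by (rule has_sum_SigmaD[OF S']) (use g in simp)
  with S have "S' = S" using has_sum_unique by blast
  with S' show ?thesis by simp
qed

text \<open>The outermost tail sum runs over the smallest index \<open>j\<close>, so the induction
  appends entries on the right and matches a pair \<open>(j, m)\<close> with the tuple
  \<open>m @ [j]\<close>.\<close>

lemma has_sum_fold_tail_sum:
  assumes w: "\<And>n. 0 \<le> w n \<and> w n \<le> 1" and "a \<noteq> []" "0 \<notin> set a" "hd a \<ge> 2"
  shows "((\<lambda>m. w (hd m) * (\<Prod>i<length m. 1 / real (m ! i) ^ (a ! i))) has_sum fold tail_sum a w n)
    {m. length m = length a \<and> sorted_wrt (>) m \<and> (\<forall>i \<in> set m. i > n)}"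
  using assms(2-)
proof (induction a arbitrary: n rule: rev_nonempty_induct)
  case (single k)
  have "((\<lambda>j. w j / real j ^ k) has_sum fold tail_sum [k] w n) {n<..}"
    using summable_tail_fold[of w "[]" k n] single w by (auto intro!: has_sum_tail_sum)
  then show ?case
    by (rule iffD1[OF has_sum_reindex_bij_witness[of _ hd "\<lambda>j. [j]"], rotated -1])
      (auto simp: length_Suc_conv)
next
  case (snoc k b)
  let ?D = "\<lambda>r n. {m. length m = r \<and> sorted_wrt (>) m \<and> (\<forall>i \<in> set m. (i::nat) > n)}"
  let ?f = "\<lambda>j m. w (hd m) * (\<Prod>i<length m. 1 / real (m ! i) ^ (b ! i)) / real j ^ k"
  have b: "0 \<notin> set b" "2 \<le> hd b" using snoc by auto
  have nonneg: "0 \<le> fold tail_sum b w m" for m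
    using decays_fold_bounded[OF w b(1) snoc.hyps b(2)] by (simp add: decays_def)
  have "((\<lambda>j. fold tail_sum b w j / real j ^ k) has_sum tail_sum k (fold tail_sum b w) n) {n<..}"
    by (intro has_sum_tail_sum nonneg summable_tail_fold w snoc.prems)
  moreover have "(?f j has_sum fold tail_sum b w j / real j ^ k) (?D (length b) j)" for j
    using has_sum_cmult_left[OF snoc.IH[OF b, of j], where c = "1 / real j ^ k"] by simp
  ultimately have "((\<lambda>(j, m). ?f j m) has_sum tail_sum k (fold tail_sum b w) n) (Sigma {n<..} (?D (length b)))"
    by (intro has_sum_SigmaI_nonneg)
      (use w in \<open>auto intro!: mult_nonneg_nonneg prod_nonneg divide_nonneg_nonneg\<close>)
  then show ?case
  proof (rule iffD1[OF has_sum_reindex_bij_witness[of _ "\<lambda>m. (last m, butlast m)" "\<lambda>(j, m). m @ [j]"], rotated -1])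
    fix p assume p: "p \<in> Sigma {n<..} (?D (length b))"
    obtain j m where jm: "p = (j, m)" by fastforce
    then have len: "length m = length b" using p by simp
    then have "m \<noteq> []" using snoc.hyps by auto
    with len show "w (hd (case p of (j, m) \<Rightarrow> m @ [j])) *
        (\<Prod>i<length (case p of (j, m) \<Rightarrow> m @ [j]).
          1 / real ((case p of (j, m) \<Rightarrow> m @ [j]) ! i) ^ ((b @ [k]) ! i)) = (case p of (j, m) \<Rightarrow> ?f j m)"
      by (simp add: jm nth_append)
    show "(case p of (j, m) \<Rightarrow> m @ [j]) \<in> ?D (length (b @ [k])) n"
      using p snoc_in_decreasing_iff[of m j "length b" n] by (simp add: jm)
    show "(last (case p of (j, m) \<Rightarrow> m @ [j]), butlast (case p of (j, m) \<Rightarrow> m @ [j])) = p"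
      by (simp add: jm)
  next
    fix m assume m: "m \<in> ?D (length (b @ [k])) n"
    then have "m = butlast m @ [last m]" by (cases m) auto
    then show "(case (last m, butlast m) of (j, m) \<Rightarrow> m @ [j]) = m" by simp
    show "(last m, butlast m) \<in> Sigma {n<..} (?D (length b))"
      using m snoc_in_decreasing_iff[of "butlast m" "last m" "length b" n]
        \<open>m = butlast m @ [last m]\<close> by simp
  qed simp
qed

section \<open>Double tails and the recursion on the diagonal\<close>

lemma parts_hd: "a \<noteq> empty_acomp \<Longrightarrow> hd (parts a) \<ge> 2"
  using parts[of a] by simp

lemma zeta_nn_eq: "zeta_nn a n = fold tail_sum (parts a) (inv_binom n) n"
proof (cases "a = empty_acomp")
  case True
  then show ?thesis by (simp add: zeta_nn_def inv_binom_def mult_2)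
next
  case False
  have "((\<lambda>m. inv_binom n (hd m) * (\<Prod>i<length m. 1 / real (m ! i) ^ (parts a ! i)))
      has_sum fold tail_sum (parts a) (inv_binom n) n)
    {m. length m = length (parts a) \<and> sorted_wrt (>) m \<and> (\<forall>i \<in> set m. i > n)}"
    by (intro has_sum_fold_tail_sum inv_binom_bounds parts_pos parts_hd False) (simp add: False)
  then show ?thesis using False by (simp add: zeta_nn_def infsumI inv_binom_def)
qed

text \<open>The two roles of \<open>n\<close> in \<open>zeta_nn\<close> are separated:
  \<open>p\<close> bounds the indices from below and \<open>q\<close> enters the binomial
  coefficient. Each can then be raised on its own.\<close>

definition double_tail :: "acomp \<Rightarrow> nat \<Rightarrow> nat \<Rightarrow> real" where
  "double_tail a p q = fold tail_sum (parts a) (inv_binom q) p"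

lemma double_tail_rec_left:
  assumes "a \<noteq> empty_acomp"
  shows "double_tail a p q = double_tail a (Suc p) q
    + double_tail (init a) (Suc p) q / real (Suc p) ^ (weight a - weight (init a))"
  using fold_tail_sum_rec[of "inv_binom q", OF inv_binom_bounds parts_pos _ parts_hd[OF assms], of p] assms
    weight_init_last[OF assms]
  by (simp add: double_tail_def init.rep_eq)

lemma double_tail_rec_right:
  assumes "a \<noteq> empty_acomp"
  shows "double_tail a p q = double_tail a p (Suc q)
    + double_tail (fin a) p (Suc q) / real (Suc q) ^ (weight a - weight (fin a))"
  using fold_tail_sum_rec_fin[OF parts_pos _ parts_hd[OF assms], of q p] assms
  by (simp add: double_tail_def parts_fin weight.rep_eq)

text \<open>With \<open>x = n + 1\<close> the factor is \<open>(4 * x - 2) / x\<close>, the ratio of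
  consecutive central binomial coefficients.\<close>

lemma inv_binom_diag: "inv_binom n n = (4 * real (Suc n) - 2) / real (Suc n) * inv_binom (Suc n) (Suc n)"
proof -
  have *: "inv_binom n (Suc n) = 2 * inv_binom (Suc n) (Suc n)"
    using inv_binom_rec_q[of n "Suc n"] by simp
  have "inv_binom n n = inv_binom (Suc n) n * (1 + real n / real (Suc n))"
    using inv_binom_rec_q[of n n] by (simp add: algebra_simps)
  also have "inv_binom (Suc n) n = 2 * inv_binom (Suc n) (Suc n)"
    using * inv_binom_commute[of n "Suc n"] by simp
  finally show ?thesis by (simp add: field_simps)
qed

text \<open>The step from \<open>(n, n)\<close> to \<open>(n + 1, n + 1)\<close> raises
  \<open>p\<close> first, producing \<open>a\<close> and \<open>init a\<close>, and then
  \<open>q\<close> in both terms. This adds \<open>fin a\<close> and \<open>fin (init a)\<close>,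
  and the latter is \<open>mid a\<close>.\<close>

lemma zeta_nn_rec:
  assumes "a \<noteq> empty_acomp"
  shows "zeta_nn a n = zeta_nn a (Suc n)
    + zeta_nn (init a) (Suc n) / real (Suc n) ^ (weight a - weight (init a))
    + zeta_nn (mid a) (Suc n) / real (Suc n) ^ (weight a - weight (mid a))
    + zeta_nn (fin a) (Suc n) / real (Suc n) ^ (weight a - weight (fin a))"
proof -
  let ?N = "Suc n"
  have mid: "mid a = fin (init a)" by (simp add: mid_def fin_init)
  have "double_tail (init a) ?N n = double_tail (init a) ?N ?N
      + double_tail (mid a) ?N ?N / real ?N ^ (weight (init a) - weight (mid a))"
  proof (cases "init a = empty_acomp")
    case False
    then show ?thesis unfolding mid by (rule double_tail_rec_right)
  next
    \<comment> \<open>For the empty composition \<open>inv_binom n (n + 1)\<close> is twice the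
      diagonal value at \<open>n + 1\<close>. Since \<open>mid a\<close> is empty as well and the
      exponent is 0, the second copy is the \<open>mid\<close> term.\<close>
    case True
    then have "mid a = empty_acomp"
      unfolding mid
      by (simp add: fin_def)
        (metis True init.rep_eq parts_empty_acomp butlast.simps(1) parts_eq_Nil dual_empty_acomp)
    then show ?thesis
      using True inv_binom_rec_q[of n ?N] by (simp add: double_tail_def)
  qed
  then have "double_tail (init a) ?N n / real ?N ^ (weight a - weight (init a)) =
     double_tail (init a) ?N ?N / real ?N ^ (weight a - weight (init a)) +
     double_tail (mid a) ?N ?N / real ?N ^ ((weight (init a) - weight (mid a)) + (weight a - weight (init a)))"
    by (simp add: add_divide_distrib power_add)
  also have "(weight (init a) - weight (mid a)) + (weight a - weight (init a)) = weight a - weight (mid a)"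
  proof -
    have "weight (mid a) \<le> weight (init a)"
      unfolding mid using weight_init_le[of "dual (init a)"] by (simp add: fin_def)
    then show ?thesis using weight_init_le[of a] by simp
  qed
  finally show ?thesis
    using double_tail_rec_left[OF assms, of n n] double_tail_rec_right[OF assms, of ?N n]
    by (simp add: zeta_nn_eq flip: double_tail_def)
qed

lemma zeta_nn_tendsto:
  assumes "a \<noteq> empty_acomp"
  shows "zeta_nn a \<longlonglongrightarrow> 0"
proof (rule tendsto_sandwich[of "\<lambda>_. 0" _ _ "\<lambda>n. 2 / (real n + 1)"])
  have "decays 2 (fold tail_sum (parts a) (inv_binom n))" for n
    by (intro decays_fold_bounded inv_binom_bounds parts_pos parts_hd assms) (simp add: assms)
  then have "0 \<le> zeta_nn a n \<and> zeta_nn a n \<le> 2 / (real n + 1)" for n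
    by (simp add: zeta_nn_eq decays_def)
  then show "eventually (\<lambda>n. 0 \<le> zeta_nn a n) sequentially"
    "eventually (\<lambda>n. zeta_nn a n \<le> 2 / (real n + 1)) sequentially" by auto
qed (auto intro: tendsto_divide_Suc)

text \<open>The binomial weight now depends on the largest summation index instead of
  \<open>n\<close>, so lowering \<open>n\<close> affects only the range of summation.\<close>

definition central_tail :: "nat list \<Rightarrow> nat \<Rightarrow> real" where
  "central_tail a = fold tail_sum a (\<lambda>n. inv_binom n n)"

lemma central_tail_Nil: "central_tail [] n = inv_binom n n"
  by (simp add: central_tail_def)

lemma central_tail_rec:
  assumes "0 \<notin> set a" "a \<noteq> []" "hd a \<ge> 2"
  shows "central_tail a n = central_tail a (Suc n)
    + central_tail (butlast a) (Suc n) / real (Suc n) ^ last a"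
  unfolding central_tail_def by (rule fold_tail_sum_rec[OF inv_binom_bounds assms])

lemma central_tail_tendsto:
  assumes "0 \<notin> set a" "a \<noteq> []" "hd a \<ge> 2"
  shows "central_tail a \<longlonglongrightarrow> 0"
  unfolding central_tail_def by (rule decays_tendsto[OF decays_fold_bounded[OF inv_binom_bounds assms]])

section \<open>Evaluation of formal combinations, and zeta values through
  \<open>delta\<close>\<close>

definition frag_eval :: "('a \<Rightarrow> real) \<Rightarrow> ('a \<Rightarrow>\<^sub>0 int) \<Rightarrow> real" where
  "frag_eval f x = (\<Sum>c\<in>Poly_Mapping.keys x. real_of_int (Poly_Mapping.lookup x c) * f c)"

lemma frag_eval_superset:
  assumes "finite S" "Poly_Mapping.keys x \<subseteq> S"
  shows "frag_eval f x = (\<Sum>c\<in>S. real_of_int (Poly_Mapping.lookup x c) * f c)"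
  unfolding frag_eval_def using assms
  by (intro sum.mono_neutral_left) (auto simp: in_keys_iff)

lemma frag_eval_diff: "frag_eval f (x - y) = frag_eval f x - frag_eval f y"
proof -
  let ?S = "Poly_Mapping.keys x \<union> Poly_Mapping.keys y"
  have "Poly_Mapping.keys (x - y) \<subseteq> ?S" by (rule keys_diff)
  then show ?thesis
    by (simp add: frag_eval_superset[of ?S] lookup_minus algebra_simps sum_subtractf)
qed

lemma frag_eval_0 [simp]: "frag_eval f 0 = 0"
  by (simp add: frag_eval_def)

lemma frag_eval_add: "frag_eval f (x + y) = frag_eval f x + frag_eval f y"
  using frag_eval_diff[of f "x + y" y] by simp

lemma frag_eval_of [simp]: "frag_eval f (frag_of a) = f a"
  by (simp add: frag_eval_def)

lemma frag_eval_extend: "frag_eval f (frag_extend g x) = frag_eval (\<lambda>b. frag_eval f (g b)) x"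
proof -
  have "Poly_Mapping.keys x \<subseteq> UNIV" by simp
  then show ?thesis
    by (induction x rule: frag_induction) (simp_all add: frag_extend_diff frag_eval_diff)
qed

lemma frag_eval_cong:
  "(\<And>c. c \<in> Poly_Mapping.keys x \<Longrightarrow> f c = g c) \<Longrightarrow> frag_eval f x = frag_eval g x"
  by (simp add: frag_eval_def)

lemma frag_eval_linear: "frag_eval (\<lambda>c. f c + g c * d) x = frag_eval f x + frag_eval g x * d"
  by (simp add: frag_eval_def algebra_simps sum.distrib sum_distrib_left)

lemma frag_eval_tendsto:
  assumes "\<And>c. c \<in> Poly_Mapping.keys x \<Longrightarrow> (\<lambda>n. f n c) \<longlonglongrightarrow> 0"
  shows "(\<lambda>n. frag_eval (f n) x) \<longlonglongrightarrow> 0"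
  unfolding frag_eval_def by (intro tendsto_null_sum tendsto_mult_right_zero assms)

text \<open>By induction on the weight both sides have the same increments in \<open>n\<close>, and
  for nonempty \<open>a\<close> both tend to 0.\<close>

lemma zeta_nn_eq_frag_eval:
  "zeta_nn a n = frag_eval (\<lambda>c. central_tail (parts c) n) (delta_acomp a)"
proof (induction "weight a" arbitrary: a n rule: less_induct)
  case less
  let ?E = "\<lambda>n x. frag_eval (\<lambda>c. central_tail (parts c) n) x"
  show ?case
  proof (cases "a = empty_acomp")
    case True
    then show ?thesis by (simp add: delta_acomp.simps[of empty_acomp] zeta_nn_eq central_tail_Nil)
  next
    case False
    have keys: "weight c = weight b" if "c \<in> Poly_Mapping.keys (delta_acomp b)" for b c
      using delta_acomp_in[of b] that by (auto simp: free_on_def A_wt_def)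
    have ne: "c \<noteq> empty_acomp" if "c \<in> Poly_Mapping.keys (delta_acomp a)" for c
      using keys[OF that] False by (metis weight_eq_0)
    define D where "D n = zeta_nn a n - ?E n (delta_acomp a)" for n
    have "D n = D (Suc n)" for n
    proof -
      let ?N = "Suc n"
      \<comment> \<open>The power depends on \<open>c\<close> only through its weight, hence is a
        constant factor on the homogeneous element \<open>delta_acomp b\<close>. At
        \<open>init c\<close> it is the power split off with the last entry of
        \<open>c\<close>.\<close>
      let ?g = "\<lambda>c. central_tail (parts c) ?N / real ?N ^ (weight a - weight c)"
      have *: "frag_eval ?g (delta_acomp b) = zeta_nn b ?N / real ?N ^ (weight a - weight b)"
        if "weight b < weight a" for b
      proof -
        have "frag_eval ?g (delta_acomp b) =
          frag_eval (\<lambda>c. 0 + central_tail (parts c) ?N * (1 / real ?N ^ (weight a - weight b))) (delta_acomp b)"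
          by (rule frag_eval_cong) (simp add: keys)
        also have "\<dots> = ?E ?N (delta_acomp b) * (1 / real ?N ^ (weight a - weight b))"
          unfolding frag_eval_linear by (simp add: frag_eval_def)
        finally show ?thesis using less[OF that] by simp
      qed
      have "?E n (delta_acomp a) =
        frag_eval (\<lambda>c. central_tail (parts c) ?N + ?g (init c) * 1) (delta_acomp a)"
      proof (rule frag_eval_cong)
        fix c assume c: "c \<in> Poly_Mapping.keys (delta_acomp a)"
        have "last (parts c) = weight a - weight (init c)"
          using weight_init_last[OF ne[OF c]] keys[OF c] by simp
        then show "central_tail (parts c) n = central_tail (parts c) ?N + ?g (init c) * 1"
          using central_tail_rec[OF parts_pos _ parts_hd[OF ne[OF c]], of n] ne[OF c]
          by (simp add: init.rep_eq)
      qed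
      also have "\<dots> = ?E ?N (delta_acomp a) + frag_eval (\<lambda>c. ?g (init c)) (delta_acomp a)"
        unfolding frag_eval_linear by simp
      also have "frag_eval (\<lambda>c. ?g (init c)) (delta_acomp a) = frag_eval ?g (init_lin (delta_acomp a))"
        by (simp add: init_lin_def frag_eval_extend)
      also have "\<dots> = zeta_nn (init a) ?N / real ?N ^ (weight a - weight (init a))
          + zeta_nn (mid a) ?N / real ?N ^ (weight a - weight (mid a))
          + zeta_nn (fin a) ?N / real ?N ^ (weight a - weight (fin a))"
        unfolding init_lin_delta_acomp[OF False] frag_eval_add
        by (simp only: * weight_init_less weight_mid_less weight_fin_less False not_False_eq_True)
      finally show ?thesis unfolding D_def using zeta_nn_rec[OF False, of n] by linarith
    qed
    then have const: "D n = D 0" for n by (induction n) auto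
    have "(\<lambda>n. ?E n (delta_acomp a)) \<longlonglongrightarrow> 0"
      by (rule frag_eval_tendsto) (use ne parts_hd in \<open>auto intro!: central_tail_tendsto parts_pos\<close>)
    then have "D \<longlonglongrightarrow> 0 - 0"
      unfolding D_def by (intro tendsto_diff zeta_nn_tendsto False)
    moreover have "D \<longlonglongrightarrow> D n" using const by (metis (no_types, lifting) ext tendsto_const)
    ultimately have "D n = 0" using LIMSEQ_unique by fastforce
    then show ?thesis by (simp add: D_def)
  qed
qed

text \<open>Duality of the values, which makes the definite description meaningful, follows from
  that of \<open>delta_acomp\<close>.\<close>

lemma zeta_nn_cls_eq: "zeta_nn_cls (cls a) n = zeta_nn a n"
  unfolding zeta_nn_cls_def
proof (rule the_equality)
  show "\<forall>b. cls b = cls a \<longrightarrow> zeta_nn b n = zeta_nn a n"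
    by (auto simp: cls_eq_iff zeta_nn_eq_frag_eval delta_acomp_dual)
qed auto

text \<open>The kernel of \<open>delta\<close> is thereby contained in the module of vanishing
  combinations; the converse amounts to independence of the central tails.\<close>

lemma zeta_nn_lin_eq: "zeta_nn_lin l n = frag_eval (\<lambda>c. central_tail (parts c) n) (delta l)"
proof -
  have "zeta_nn_cls b n = frag_eval (\<lambda>c. central_tail (parts c) n) (delta (frag_of b))" for b
  proof -
    obtain a where "b = cls a" using cls_surj by blast
    then show ?thesis by (simp add: zeta_nn_cls_eq zeta_nn_eq_frag_eval is_delta_cls[OF is_delta_delta])
  qed
  moreover have "delta l = frag_extend (\<lambda>b. delta (frag_of b)) l"
    using is_delta_delta by (intro module_hom_eq_frag_extend) (simp add: is_delta_def)
  ultimately show ?thesis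
    by (simp only: frag_eval_extend) (simp add: zeta_nn_lin_def frag_eval_def)
qed


section \<open>Integer poles of rational functions under a unit shift\<close>

section \<open>Rational solutions of difference equations\<close>

lemma eventually_poly_nonzero:
  fixes Q :: "real poly"
  assumes "Q \<noteq> 0"
  shows "eventually (\<lambda>x. poly Q x \<noteq> 0) (at x0)"
proof -
  have "finite {x. poly Q x = 0}" by (rule poly_roots_finite[OF assms])
  then have "\<not> x0 islimpt {x. poly Q x = 0}" by (rule islimpt_finite)
  then show ?thesis by (simp add: islimpt_iff_eventually)
qed

text \<open>For a rational function this says that \<open>x0\<close> is not a pole. A punctured
  limit ignores the value at \<open>x0\<close>, which division by zero may have made
  arbitrary.\<close>

definition regular_at :: "(real \<Rightarrow> real) \<Rightarrow> real \<Rightarrow> bool" where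
  "regular_at g x0 \<longleftrightarrow> (\<exists>l. (g \<longlongrightarrow> l) (at x0))"

lemma regular_at_shift: "regular_at (\<lambda>x. g (x - 1)) x0 \<longleftrightarrow> regular_at g (x0 - 1)"
proof -
  have "((\<lambda>x. g (x - 1)) \<longlongrightarrow> l) (at x0) \<longleftrightarrow> (g \<longlongrightarrow> l) (at (x0 - 1))" for l
  proof -
    have "at x0 = filtermap (\<lambda>x. x + 1) (at (x0 - 1))"
      by (subst (2) at_to_0, subst at_to_0) (simp add: filtermap_filtermap algebra_simps)
    then show ?thesis by (simp add: filterlim_filtermap)
  qed
  then show ?thesis by (simp add: regular_at_def)
qed

text \<open>The functional equation moves the largest integer pole \<open>p\<close> to \<open>p + 1\<close> and leaves the smallest
  one in place, so both would have to be cancelled at \<open>0\<close>.\<close>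

lemma rational_difference_regular:
  fixes R Q :: "real poly" and v h :: "real \<Rightarrow> real"
  defines "g \<equiv> \<lambda>x. poly R x / poly Q x"
  assumes "Q \<noteq> 0"
    and eq: "\<And>x0. eventually (\<lambda>x. g x - v x * g (x - 1) = h x) (at x0)"
    and v: "\<And>z::int. z \<noteq> 0 \<Longrightarrow> \<exists>l. l \<noteq> 0 \<and> (v \<longlongrightarrow> l) (at (of_int z))"
    and h: "\<And>z::int. z \<noteq> 0 \<Longrightarrow> regular_at h (of_int z)"
  shows "regular_at g (of_int z)"
proof (rule ccontr)
  assume "\<not> regular_at g (of_int z)"
  define N where "N = {z::int. \<not> regular_at g (of_int z)}"
  have reg: "regular_at g x" if "poly Q x \<noteq> 0" for x
    unfolding regular_at_def g_def
    by (rule exI, rule tendsto_divide[OF tendsto_poly tendsto_poly that]) (rule tendsto_ident_at)+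
  have "real_of_int ` N \<subseteq> {x. poly Q x = 0}"
    using reg by (auto simp: N_def)
  then have "finite (real_of_int ` N)"
    using poly_roots_finite[OF \<open>Q \<noteq> 0\<close>] finite_subset by blast
  then have fin: "finite N" by (rule finite_imageD) (auto simp: inj_on_def)
  have ne: "N \<noteq> {}" using \<open>\<not> regular_at g (of_int z)\<close> by (auto simp: N_def)
  define p where "p = Max N"
  define q where "q = Min N"
  have p: "p \<in> N" "p + 1 \<notin> N" and q: "q \<in> N" "q - 1 \<notin> N" and "q \<le> p"
    using fin ne Max_ge[of N "p + 1"] Min_le[of N "q - 1"] by (auto simp: p_def q_def)
  \<comment> \<open>Otherwise \<open>g\<close> and \<open>h\<close> are regular at
    \<open>p + 1\<close> and \<open>v\<close> has a nonzero limit there, so solving the equation for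
    \<open>g (x - 1)\<close> would make \<open>g\<close> regular at \<open>p\<close>.\<close>
  have "p + 1 = 0"
  proof (rule ccontr)
    assume nz: "p + 1 \<noteq> 0"
    obtain l where l: "l \<noteq> 0" "(v \<longlongrightarrow> l) (at (of_int (p + 1)))" using v[OF nz] by blast
    obtain a b where "(g \<longlongrightarrow> a) (at (of_int (p + 1)))" "(h \<longlongrightarrow> b) (at (of_int (p + 1)))"
      using h[OF nz] p(2) by (auto simp: N_def regular_at_def)
    with l have "((\<lambda>x. (g x - h x) / v x) \<longlongrightarrow> (a - b) / l) (at (of_int (p + 1)))"
      by (intro tendsto_intros)
    moreover have "eventually (\<lambda>x. v x \<noteq> 0) (at (of_int (p + 1)))"
      using l by (metis tendsto_imp_eventually_ne)
    then have "eventually (\<lambda>x. (g x - h x) / v x = g (x - 1)) (at (of_int (p + 1)))"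
      using eq[of "of_int (p + 1)"] by eventually_elim (auto simp: field_simps)
    ultimately have "((\<lambda>x. g (x - 1)) \<longlongrightarrow> (a - b) / l) (at (of_int (p + 1)))"
      by (rule Lim_transform_eventually)
    then have "regular_at (\<lambda>x. g (x - 1)) (of_int (p + 1))"
      unfolding regular_at_def by blast
    with p(1) show False by (simp add: regular_at_shift N_def)
  qed
  \<comment> \<open>Now \<open>q \<le> -1\<close>, so the equation may be used at \<open>q\<close>;
    there \<open>g (x - 1)\<close> is regular by minimality, and this forces \<open>g\<close> to be
    regular at \<open>q\<close>.\<close>
  with \<open>q \<le> p\<close> have nz: "q \<noteq> 0" by simp
  obtain l where l: "(v \<longlongrightarrow> l) (at (of_int q))" using v[OF nz] by blast
  have "regular_at (\<lambda>x. g (x - 1)) (of_int q)"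
    using q(2) by (simp add: regular_at_shift N_def)
  then obtain a b where "((\<lambda>x. g (x - 1)) \<longlongrightarrow> a) (at (of_int q))" "(h \<longlongrightarrow> b) (at (of_int q))"
    using h[OF nz] by (auto simp: regular_at_def)
  with l have "((\<lambda>x. h x + v x * g (x - 1)) \<longlongrightarrow> b + l * a) (at (of_int q))"
    by (intro tendsto_intros)
  moreover have "eventually (\<lambda>x. h x + v x * g (x - 1) = g x) (at (of_int q))"
    using eq[of "of_int q"] by eventually_elim auto
  ultimately have "(g \<longlongrightarrow> b + l * a) (at (of_int q))"
    by (rule Lim_transform_eventually)
  with q(1) show False by (auto simp: N_def regular_at_def)
qed

text \<open>If \<open>e k\<close> is the largest exponent with nonzero coefficient, multiplying by a
  further \<open>x ^ (e k - s)\<close> gives limit 0 by hypothesis, but limit \<open>\<mu> k\<close>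
  by direct computation.\<close>

lemma principal_part_zero:
  fixes \<mu> :: "'i \<Rightarrow> real" and e :: "'i \<Rightarrow> nat"
  assumes fin: "finite J" and inj: "inj_on e J" and gt: "\<And>i. i \<in> J \<Longrightarrow> e i > s"
    and lim: "((\<lambda>x. x ^ s * (\<Sum>i\<in>J. \<mu> i / x ^ e i)) \<longlongrightarrow> l) (at 0)"
    and "i \<in> J"
  shows "\<mu> i = 0"
proof (rule ccontr)
  assume "\<mu> i \<noteq> 0"
  define J' where "J' = {i\<in>J. \<mu> i \<noteq> 0}"
  have J': "finite (e ` J')" "e ` J' \<noteq> {}" using fin \<open>i \<in> J\<close> \<open>\<mu> i \<noteq> 0\<close> by (auto simp: J'_def)
  then obtain k where k: "k \<in> J'" "e k = Max (e ` J')" using Max_in[OF J'] by force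
  have le: "e j < e k" if "j \<in> J'" "j \<noteq> k" for j
  proof -
    have "e j \<le> e k" using that k J' by simp
    moreover have "e j \<noteq> e k" using that k inj by (auto simp: J'_def inj_on_def)
    ultimately show ?thesis by simp
  qed
  have "((\<lambda>x. x ^ (e k - s) * (x ^ s * (\<Sum>i\<in>J. \<mu> i / x ^ e i))) \<longlongrightarrow> 0 ^ (e k - s) * l) (at 0)"
    by (intro tendsto_intros lim)
  moreover have "e k > s" using k(1) gt by (auto simp: J'_def)
  ultimately have lim0: "((\<lambda>x. x ^ (e k - s) * (x ^ s * (\<Sum>i\<in>J. \<mu> i / x ^ e i))) \<longlongrightarrow> 0) (at 0)"
    by (simp add: power_0_left)
  have lim1: "((\<lambda>x. \<Sum>i\<in>J'. \<mu> i * x ^ (e k - e i)) \<longlongrightarrow> (\<Sum>i\<in>J'. \<mu> i * 0 ^ (e k - e i))) (at (0::real))"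
    by (intro tendsto_intros)
  have "(\<Sum>i\<in>J'. \<mu> i * 0 ^ (e k - e i)) = (\<Sum>i\<in>J'. if i = k then \<mu> k else 0)"
  proof (intro sum.cong refl)
    fix i assume "i \<in> J'"
    then show "\<mu> i * 0 ^ (e k - e i) = (if i = k then \<mu> k else 0)"
      using le[of i] by (cases "i = k") (simp_all add: power_0_left)
  qed
  also have "\<dots> = \<mu> k" using k fin by (simp add: J'_def)
  finally have coeff: "(\<Sum>i\<in>J'. \<mu> i * 0 ^ (e k - e i)) = \<mu> k" .
  have "eventually (\<lambda>x. (\<Sum>i\<in>J'. \<mu> i * x ^ (e k - e i))
      = x ^ (e k - s) * (x ^ s * (\<Sum>i\<in>J. \<mu> i / x ^ e i))) (at (0::real))"
    unfolding eventually_at_filter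
  proof (intro always_eventually allI impI)
    fix x :: real assume x: "x \<noteq> 0"
    have J: "(\<Sum>i\<in>J. \<mu> i / x ^ e i) = (\<Sum>i\<in>J'. \<mu> i / x ^ e i)"
      using fin by (intro sum.mono_neutral_right) (auto simp: J'_def)
    have "x ^ (e k - s) * (x ^ s * (\<Sum>i\<in>J. \<mu> i / x ^ e i)) = x ^ e k * (\<Sum>i\<in>J'. \<mu> i / x ^ e i)"
      unfolding J using \<open>e k > s\<close> by (simp flip: power_add mult.assoc)
    also have "\<dots> = (\<Sum>i\<in>J'. \<mu> i * x ^ (e k - e i))"
      unfolding sum_distrib_left
    proof (intro sum.cong refl)
      fix i assume "i \<in> J'"
      then have "e i \<le> e k" using le[of i] by force
      then show "x ^ e k * (\<mu> i / x ^ e i) = \<mu> i * x ^ (e k - e i)" using x by (simp add: power_diff)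
    qed
    finally show "(\<Sum>i\<in>J'. \<mu> i * x ^ (e k - e i)) = x ^ (e k - s) * (x ^ s * (\<Sum>i\<in>J. \<mu> i / x ^ e i))" ..
  qed
  from Lim_transform_eventually[OF lim1 this]
  have "((\<lambda>x. x ^ (e k - s) * (x ^ s * (\<Sum>i\<in>J. \<mu> i / x ^ e i))) \<longlongrightarrow> \<mu> k) (at 0)"
    unfolding coeff .
  with lim0 have "\<mu> k = 0" using tendsto_unique trivial_limit_at by blast
  with k show False by (simp add: J'_def)
qed

lemma regular_at_principal_part: "x0 \<noteq> 0 \<Longrightarrow> regular_at (\<lambda>x. \<Sum>i\<in>J. \<mu> i / x ^ e i) x0"
  unfolding regular_at_def
  by (rule exI[of _ "\<Sum>i\<in>J. \<mu> i / x0 ^ e i"], intro tendsto_intros) auto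

lemma poly_eq_0_if_eventually:
  fixes P :: "real poly"
  assumes "\<And>n. n \<ge> N \<Longrightarrow> poly P (real n) = 0"
  shows "P = 0"
proof (rule ccontr)
  assume "P \<noteq> 0"
  then have "finite {x. poly P x = 0}" by (rule poly_roots_finite)
  then have "finite (real ` {N..})" by (rule finite_subset[rotated]) (use assms in auto)
  then have "finite {N..}" by (rule finite_imageD) (auto simp: inj_on_def)
  then show False by (simp add: infinite_Ici)
qed

definition shift :: "real poly \<Rightarrow> real poly" where
  "shift P = pcompose P [:-1, 1:]"

lemma poly_shift [simp]: "poly (shift P) x = poly P (x - 1)"
  by (simp add: shift_def poly_pcompose)

lemma shift_nonzero: "Q \<noteq> 0 \<Longrightarrow> shift Q \<noteq> 0"
  by (simp add: shift_def pcompose_eq_0_iff)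

text \<open>The quotient \<open>P / Q\<close> is invariant under the unit shift, hence constant on
  the integers beyond the roots of \<open>Q\<close>; a polynomial with infinitely many zeros
  vanishes.\<close>

lemma proportional_if_ratio_periodic:
  assumes "Q \<noteq> 0" "Q * shift P = shift Q * P"
  obtains c where "P = smult c Q"
proof -
  have "bdd_above {x. poly Q x = 0}" by (intro bdd_above_finite poly_roots_finite assms)
  then obtain b where b: "\<forall>x\<in>{x. poly Q x = 0}. x \<le> b" unfolding bdd_above_def by blast
  obtain N where N: "b < real N" using reals_Archimedean2 by blast
  have nz: "poly Q (real n) \<noteq> 0" if "n \<ge> N" for n
    using b N that by force
  define c where "c = poly P (real N) / poly Q (real N)"
  have "poly P (real n) = c * poly Q (real n)" if "n \<ge> N" for n
    using that
  proof (induction n rule: dec_induct)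
    case base
    show ?case using nz[of N] by (simp add: c_def)
  next
    case (step n)
    have "poly (Q * shift P) (real (Suc n)) = poly (shift Q * P) (real (Suc n))"
      using assms(2) by simp
    then have "poly Q (real (Suc n)) * poly P (real n) = poly Q (real n) * poly P (real (Suc n))"
      by simp
    then show ?case using step nz[of n] by (simp add: mult.commute)
  qed
  then have "P - smult c Q = 0" by (intro poly_eq_0_if_eventually[of N]) simp
  then show ?thesis by (intro that[of c]) simp
qed


section \<open>Independence of the central tails over polynomials\<close>

section \<open>Linear independence\<close>

text \<open>The solution is regular at 0 and -1, and \<open>x ^ s\<close> tames \<open>v\<close> at
  0. The right-hand side multiplied by \<open>x ^ s\<close> thus has a finite limit at 0, which
  exponents above \<open>s\<close> permit only for zero coefficients.\<close>

lemma no_rational_solution: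
  fixes R Q :: "real poly" and v :: "real \<Rightarrow> real" and \<mu> :: "'i \<Rightarrow> real" and e :: "'i \<Rightarrow> nat"
  assumes Q: "Q \<noteq> 0" and J: "finite J" "inj_on e J" "\<And>i. i \<in> J \<Longrightarrow> e i > s"
    and eq: "\<And>x. x \<noteq> 0 \<Longrightarrow> poly Q x \<noteq> 0 \<Longrightarrow> poly Q (x - 1) \<noteq> 0 \<Longrightarrow>
      poly R x / poly Q x - v x * (poly R (x - 1) / poly Q (x - 1)) = (\<Sum>i\<in>J. \<mu> i / x ^ e i)"
    and v: "\<And>z::int. z \<noteq> 0 \<Longrightarrow> \<exists>l. l \<noteq> 0 \<and> (v \<longlongrightarrow> l) (at (of_int z))"
    and v0: "((\<lambda>x. x ^ s * v x) \<longlongrightarrow> l0) (at 0)"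
    and "i \<in> J"
  shows "\<mu> i = 0"
proof -
  define g where "g = (\<lambda>x. poly R x / poly Q x)"
  have ev: "eventually (\<lambda>x. g x - v x * g (x - 1) = (\<Sum>i\<in>J. \<mu> i / x ^ e i)) (at x0)" for x0
    using eventually_poly_nonzero[of "[:0, 1:]" x0, simplified] eventually_poly_nonzero[OF Q, of x0]
      eventually_poly_nonzero[OF shift_nonzero[OF Q], of x0, unfolded poly_shift]
    unfolding g_def by eventually_elim (rule eq)
  have reg: "regular_at g (of_int z)" for z
    unfolding g_def
    by (rule rational_difference_regular[OF Q ev[unfolded g_def] v])
      (auto intro: regular_at_principal_part)
  obtain a where a: "(g \<longlongrightarrow> a) (at 0)" using reg[of 0] by (auto simp: regular_at_def)
  have "regular_at (\<lambda>x. g (x - 1)) 0" using reg[of "-1"] by (simp add: regular_at_shift)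
  then obtain b where b: "((\<lambda>x. g (x - 1)) \<longlongrightarrow> b) (at 0)" by (auto simp: regular_at_def)
  have "((\<lambda>x. x ^ s * g x - (x ^ s * v x) * g (x - 1)) \<longlongrightarrow> 0 ^ s * a - l0 * b) (at 0)"
    by (intro tendsto_intros a b v0)
  moreover have "eventually (\<lambda>x. x ^ s * g x - (x ^ s * v x) * g (x - 1)
      = x ^ s * (\<Sum>i\<in>J. \<mu> i / x ^ e i)) (at 0)"
    using ev[of 0] by eventually_elim (simp add: algebra_simps flip: right_diff_distrib)
  ultimately have "((\<lambda>x. x ^ s * (\<Sum>i\<in>J. \<mu> i / x ^ e i)) \<longlongrightarrow> 0 ^ s * a - l0 * b) (at 0)"
    by (rule Lim_transform_eventually)
  from principal_part_zero[OF J this \<open>i \<in> J\<close>] show ?thesis .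
qed

text \<open>Polynomial coefficients are stable under the elimination of a deepest term, unlike
  constants. Closure under \<open>butlast\<close> keeps the recursion for
  \<open>central_tail\<close> inside \<open>S\<close>.\<close>

lemma central_tail_independent:
  fixes R :: "nat list \<Rightarrow> real poly"
  assumes "finite S" "\<And>a. a \<in> S \<Longrightarrow> 0 \<notin> set a \<and> (a \<noteq> [] \<longrightarrow> hd a \<ge> 2)"
    "\<And>a. a \<in> S \<Longrightarrow> butlast a \<in> S"
    "\<And>n. n \<ge> N \<Longrightarrow> (\<Sum>a\<in>S. poly (R a) (real n) * central_tail a n) = 0"
    "a \<in> S"
  shows "R a = 0"
  using assms
proof (induction "card S" arbitrary: S R N a rule: less_induct)
  case less
  note fin = less.prems(1) and adm = less.prems(2) and closed = less.prems(3) and rel = less.prems(4)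
  have "S \<noteq> {}" using less.prems(5) by auto
  obtain c where c: "c \<in> S" "\<And>b. b \<in> S \<Longrightarrow> length b \<le> length c"
    using Max_in[of "length ` S"] Max_ge[of "length ` S"] fin \<open>S \<noteq> {}\<close>
    by (metis (no_types, lifting) finite_imageI image_iff image_is_empty)
  let ?J = "\<lambda>a. {b \<in> S. b \<noteq> [] \<and> butlast b = a}"
  have top: "?J b = {}" if "length b = length c" for b
  proof -
    have False if "d \<in> ?J b" for d
      using c(2)[of d] that \<open>length b = length c\<close> by (cases d rule: rev_cases) auto
    then show ?thesis by blast
  qed
  \<comment> \<open>As \<open>c\<close> has maximal length, it is not the \<open>butlast\<close> of
    a nonempty member, so \<open>S - {c}\<close> is still closed.\<close>
  have IH: "A b = 0"
    if "\<And>n. n \<ge> M \<Longrightarrow> (\<Sum>a\<in>S. poly (A a) (real n) * central_tail a n) = 0" "A c = 0" "b \<in> S" for A M b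
  proof (cases "b = c")
    case False
    show ?thesis
    proof (rule less.hyps[of "S - {c}" M A b])
      show "card (S - {c}) < card S" using fin c(1) by (rule card_Diff1_less)
      show "butlast a \<in> S - {c}" if "a \<in> S - {c}" for a
      proof (cases "a = []")
        case False
        then have "a \<in> ?J (butlast a)" using that by simp
        then show ?thesis using top[of c] that closed by auto
      qed (use that in auto)
      show "(\<Sum>a\<in>S - {c}. poly (A a) (real n) * central_tail a n) = 0" if "n \<ge> M" for n
        using sum.remove[OF fin c(1), of "\<lambda>a. poly (A a) (real n) * central_tail a n"]
          \<open>\<And>n. n \<ge> M \<Longrightarrow> _\<close>[OF that] \<open>A c = 0\<close> by simp
    qed (use fin adm that False in auto)
  qed (use that in simp)
  have "R c = 0"
  proof (rule ccontr)
    assume "R c \<noteq> 0"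
    define Q where "Q = R c"
    have Q: "Q \<noteq> 0" using \<open>R c \<noteq> 0\<close> by (simp add: Q_def)
    have "c \<noteq> []"
    proof
      assume "c = []"
      then have S: "S = {[]}" using c by auto
      have "Q = 0"
      proof (rule poly_eq_0_if_eventually[of N])
        fix n assume "n \<ge> N"
        from rel[OF this] show "poly Q (real n) = 0"
          by (simp add: S Q_def \<open>c = []\<close> central_tail_Nil inv_binom_def)
      qed
      with Q show False by simp
    qed
    \<comment> \<open>Multiplication by \<open>x ^ K\<close> clears all denominators. The
      \<open>Suc\<close> ensures \<open>K \<ge> 1\<close>, leaving a power for the denominator in
      the central binomial ratio.\<close>
    define K where "K = Suc (\<Sum>a\<in>S. last a)"
    have K: "last b \<le> K" if "b \<in> S" for b
      using member_le_sum[OF that, of last] fin by (simp add: K_def)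
    define X :: "real poly" where "X = [:0, 1:]"
    have X [simp]: "poly X x = x" for x by (simp add: X_def)
    \<comment> \<open>With \<open>x = n + 1\<close>, \<open>A\<close> collects the coefficients of
      \<open>x ^ K * Q(x)\<close> times the relation at \<open>n\<close>, expanded at
      \<open>n + 1\<close>, minus \<open>x ^ K * Q(n)\<close> times the relation at
      \<open>n + 1\<close>. The polynomial \<open>[:-2, 3:]\<close> comes from
      \<open>(4 * x - 2) / x = 1 + (3 * x - 2) / x\<close>.\<close>
    define A where "A a = X ^ K * (Q * shift (R a) - shift Q * R a)
      + (if a = [] then X ^ (K - 1) * [:-2, 3:] * (Q * shift (R a)) else 0)
      + Q * (\<Sum>b\<in>?J a. shift (R b) * X ^ (K - last b))" for a
    have A0: "A b = 0" if "b \<in> S" for b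
    \<comment> \<open>The bound moves to \<open>Suc N\<close> because the relation is used at both
      \<open>m\<close> and \<open>m - 1\<close>.\<close>
    proof (rule IH[of "Suc N"])
      show "A c = 0"
        using \<open>c \<noteq> []\<close> by (simp add: A_def top Q_def)
      fix m assume "m \<ge> Suc N"
      then obtain n where m: "m = Suc n" "n \<ge> N" by (cases m) auto
      define x where "x = real (Suc n)"
      have x: "x > 0" "x - 1 = real n" by (simp_all add: x_def)
      define F where "F a = central_tail a (Suc n)" for a
      define r where "r a = poly (R a) (real n)" for a
      define h where "h b = (if b \<noteq> [] then r b * x ^ (K - last b) else 0)" for b
      have step: "x ^ K * (r b * central_tail b n) = x ^ K * r b * F b
          + (if b = [] then x ^ (K - 1) * (3 * x - 2) * r b * F b else 0) + h b * F (butlast b)"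
        if "b \<in> S" for b
      proof (cases "b = []")
        case True
        have "x ^ K = x ^ (K - 1) * x" by (simp add: K_def)
        moreover have "x * central_tail b n = (4 * x - 2) * F b"
          using inv_binom_diag[of n] x by (simp add: True central_tail_Nil F_def x_def field_simps)
        ultimately have "x ^ K * (r b * central_tail b n) = x ^ (K - 1) * r b * ((4 * x - 2) * F b)"
          by (metis (no_types, lifting) mult.assoc mult.commute)
        then show ?thesis using \<open>x ^ K = x ^ (K - 1) * x\<close> True by (simp add: h_def algebra_simps)
      next
        case False
        have ct: "central_tail b n = F b + F (butlast b) / x ^ last b"
          unfolding F_def x_def using adm[OF that] False by (intro central_tail_rec) auto
        then show ?thesis using False K[OF that] x(1) by (simp add: ct h_def power_diff algebra_simps)
      qed
      have "(\<Sum>b\<in>S. h b * F (butlast b)) = (\<Sum>b\<in>{b \<in> S. b \<noteq> []}. h b * F (butlast b))"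
        using fin by (intro sum.mono_neutral_right) (auto simp: h_def)
      also have "\<dots> = (\<Sum>a\<in>S. \<Sum>b | b \<in> {b \<in> S. b \<noteq> []} \<and> butlast b = a. h b * F (butlast b))"
        using fin closed by (intro sum.group[symmetric]) auto
      also have "\<dots> = (\<Sum>a\<in>S. (\<Sum>b\<in>?J a. h b) * F a)"
        by (intro sum.cong refl) (auto simp: sum_distrib_right intro!: sum.cong)
      finally have group: "(\<Sum>b\<in>S. h b * F (butlast b)) = (\<Sum>a\<in>S. (\<Sum>b\<in>?J a. h b) * F a)" .
      have "poly (A a) x * F a = poly Q x * (x ^ K * r a * F a
          + (if a = [] then x ^ (K - 1) * (3 * x - 2) * r a * F a else 0) + (\<Sum>b\<in>?J a. h b) * F a)
          - x ^ K * poly Q (real n) * (poly (R a) x * F a)" for a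
      proof -
        have "(\<Sum>b\<in>?J a. poly (R b) (x - 1) * x ^ (K - last b)) = (\<Sum>b\<in>?J a. h b)"
          by (intro sum.cong refl) (simp add: h_def r_def x)
        then show ?thesis
          by (simp add: A_def poly_sum r_def x) (simp add: algebra_simps)
      qed
      then have "(\<Sum>a\<in>S. poly (A a) x * F a) = poly Q x * (\<Sum>a\<in>S. x ^ K * r a * F a
          + (if a = [] then x ^ (K - 1) * (3 * x - 2) * r a * F a else 0) + (\<Sum>b\<in>?J a. h b) * F a)
          - x ^ K * poly Q (real n) * (\<Sum>a\<in>S. poly (R a) x * F a)"
        by (simp only: sum_subtractf sum_distrib_left)
      also have "(\<Sum>a\<in>S. poly (R a) x * F a) = 0"
        using rel[of "Suc n"] m by (simp add: x_def F_def)
      also have "(\<Sum>a\<in>S. x ^ K * r a * F a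
          + (if a = [] then x ^ (K - 1) * (3 * x - 2) * r a * F a else 0) + (\<Sum>b\<in>?J a. h b) * F a)
        = (\<Sum>b\<in>S. x ^ K * (r b * central_tail b n))"
        by (simp only: sum.distrib group[symmetric] step cong: sum.cong)
      also have "\<dots> = x ^ K * (\<Sum>b\<in>S. r b * central_tail b n)"
        by (simp only: sum_distrib_left)
      also have "(\<Sum>b\<in>S. r b * central_tail b n) = 0"
        using rel[of n] m by (simp add: r_def)
      finally show "(\<Sum>a\<in>S. poly (A a) (real m) * central_tail a m) = 0"
        by (simp add: m x_def F_def)
    qed (rule that)
    \<comment> \<open>The vanishing of \<open>A\<close> is now read off twice: at the siblings of
      \<open>c\<close>, all of maximal length, it makes their coefficients multiples of
      \<open>Q\<close>; at the common parent \<open>e\<close> it becomes a difference equation for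
      \<open>R e / Q\<close>.\<close>
    define e where "e = butlast c"
    have e: "e \<in> S" using closed c(1) by (simp add: e_def)
    have J: "length b = length c" "b \<in> S" "b \<noteq> []" if "b \<in> ?J e" for b
    proof -
      have b: "b \<in> S" "b \<noteq> []" "butlast b = butlast c" using that by (simp_all add: e_def)
      have "length b - 1 = length c - 1" using arg_cong[OF b(3), of length] by simp
      moreover have "length b > 0" "length c > 0" using b(2) \<open>c \<noteq> []\<close> by simp_all
      ultimately show "length b = length c" by linarith
    qed (use that in simp_all)
    have "\<exists>l. R b = smult l Q" if "b \<in> ?J e" for b
    proof -
      have "X ^ K * (Q * shift (R b) - shift Q * R b) = 0"
        using A0[OF J(2)[OF that]] top[OF J(1)[OF that]] J(3)[OF that] by (simp add: A_def)
      then have "Q * shift (R b) = shift Q * R b" by (simp add: X_def)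
      from proportional_if_ratio_periodic[OF Q this] show ?thesis by blast
    qed
    then obtain l where l: "\<And>b. b \<in> ?J e \<Longrightarrow> R b = smult (l b) Q" by metis
    have ce: "c \<in> ?J e" using c(1) \<open>c \<noteq> []\<close> by (simp add: e_def)
    have "l c = 0"
    proof (rule no_rational_solution[OF Q, where J = "?J e" and e = last and \<mu> = l and R = "R e"
          and s = "if e = [] then 1 else 0"
          and v = "\<lambda>x. if e = [] then (4 * x - 2) / x else 1"])
      show "finite (?J e)" using fin by simp
      show "inj_on last (?J e)" by (rule inj_onI) (metis (mono_tags, lifting) append_butlast_last_id mem_Collect_eq)
      \<comment> \<open>For the empty parent \<open>v\<close> has a simple pole at 0, and
        admissibility makes the single entry of \<open>b\<close> at least 2. Otherwise positivity of
        the last entry suffices.\<close>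
      show "last b > (if e = [] then 1 else 0)" if b: "b \<in> ?J e" for b
      proof (cases "e = []")
        case True
        then obtain k where "b = [k]" using b by (cases b rule: rev_cases) auto
        then show ?thesis using adm[OF J(2)[OF b]] True by simp
      next
        case False
        then show ?thesis using adm[OF J(2)[OF b]] J(3)[OF b] last_in_set[of b] by (cases "last b") auto
      qed
      show "poly (R e) x / poly Q x - (if e = [] then (4 * x - 2) / x else 1) * (poly (R e) (x - 1) / poly Q (x - 1))
          = (\<Sum>b\<in>?J e. l b / x ^ last b)"
        if x: "x \<noteq> 0" and q: "poly Q x \<noteq> 0" and q': "poly Q (x - 1) \<noteq> 0" for x
      proof -
        have "(\<Sum>b\<in>?J e. poly (R b) (x - 1) * x ^ (K - last b)) =
          (\<Sum>b\<in>?J e. x ^ K * poly Q (x - 1) * (l b / x ^ last b))"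
        proof (intro sum.cong refl)
          fix b assume b: "b \<in> ?J e"
          show "poly (R b) (x - 1) * x ^ (K - last b) = x ^ K * poly Q (x - 1) * (l b / x ^ last b)"
            using l[OF b] K[OF J(2)[OF b]] x by (simp add: power_diff)
        qed
        also have "\<dots> = x ^ K * poly Q (x - 1) * (\<Sum>b\<in>?J e. l b / x ^ last b)"
          by (simp only: sum_distrib_left)
        finally have sum: "(\<Sum>b\<in>?J e. poly (R b) (x - 1) * x ^ (K - last b)) =
          x ^ K * poly Q (x - 1) * (\<Sum>b\<in>?J e. l b / x ^ last b)" .
        define H where "H = (\<Sum>b\<in>?J e. l b / x ^ last b)"
        have xK: "x ^ K = x * x ^ (K - 1)" by (simp add: K_def)
        have "poly (A e) x = 0" using A0[OF e] by simp
        then have "x ^ K * (poly Q x * poly (R e) (x - 1) - poly Q (x - 1) * poly (R e) x)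
          + (if e = [] then x ^ (K - 1) * (3 * x - 2) * (poly Q x * poly (R e) (x - 1)) else 0)
          + poly Q x * (x ^ K * poly Q (x - 1) * H) = 0"
          unfolding H_def sum[symmetric] by (cases "e = []") (simp_all add: A_def poly_sum algebra_simps)
        then have "x ^ (K - 1) * (x * (poly Q x * poly (R e) (x - 1) - poly Q (x - 1) * poly (R e) x)
          + (if e = [] then (3 * x - 2) * (poly Q x * poly (R e) (x - 1)) else 0)
          + poly Q x * (x * poly Q (x - 1) * H)) = 0"
          unfolding xK by (cases "e = []") (simp_all add: algebra_simps)
        then have "x * (poly Q x * poly (R e) (x - 1) - poly Q (x - 1) * poly (R e) x)
          + (if e = [] then (3 * x - 2) * (poly Q x * poly (R e) (x - 1)) else 0)
          + poly Q x * (x * poly Q (x - 1) * H) = 0"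
          using x by simp
        note eq = this
        show ?thesis
        proof (cases "e = []")
          case True
          with eq show ?thesis
            unfolding H_def[symmetric] using x q q' by (simp add: field_simps)
        next
          case False
          with eq have "x * (poly Q x * poly (R e) (x - 1) - poly Q (x - 1) * poly (R e) x
              + poly Q x * poly Q (x - 1) * H) = 0"
            by (simp add: algebra_simps)
          then have "poly Q x * poly (R e) (x - 1) - poly Q (x - 1) * poly (R e) x
              + poly Q x * poly Q (x - 1) * H = 0"
            using x by simp
          with False show ?thesis
            unfolding H_def[symmetric] using q q' by (simp add: field_simps)
        qed
      qed
      show "\<exists>a. a \<noteq> 0 \<and> ((\<lambda>x. if e = [] then (4 * x - 2) / x else 1) \<longlongrightarrow> a) (at (real_of_int z))"
        if z: "z \<noteq> 0" for z :: int
      proof (cases "e = []")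
        case True
        have "((\<lambda>x. (4 * x - 2) / x) \<longlongrightarrow> (4 * of_int z - 2) / of_int z) (at (of_int z :: real))"
          using z by (intro tendsto_intros) auto
        \<comment> \<open>The only zero of \<open>v\<close> is 1/2, which is not an integer.\<close>
        moreover have "4 * z - 2 \<noteq> 0" by presburger
        then have "(4 * of_int z - 2 :: real) \<noteq> 0"
          by (metis of_int_diff of_int_eq_0_iff of_int_mult of_int_numeral)
        ultimately show ?thesis using True z 
          by (intro exI[of _ "(4 * of_int z - 2) / real_of_int z"]) simp
      qed (auto intro!: exI[of _ 1])
      show "((\<lambda>x. x ^ (if e = [] then 1 else 0) * (if e = [] then (4 * x - 2) / x else 1))
          \<longlongrightarrow> (if e = [] then 4 * 0 - 2 else 1)) (at (0::real))"
      proof (cases "e = []")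
        case True
        have "((\<lambda>x. 4 * x - 2) \<longlongrightarrow> 4 * 0 - 2) (at (0::real))" by (intro tendsto_intros)
        then have "((\<lambda>x. x * ((4 * x - 2) / x)) \<longlongrightarrow> 4 * 0 - 2) (at (0::real))"
          by (rule Lim_transform_eventually) (simp add: eventually_at_filter)
        with True show ?thesis by simp
      qed simp
      show "c \<in> ?J e" by (rule ce)
    qed
    with l[OF ce] \<open>R c \<noteq> 0\<close> show False by simp
  qed
  then show ?case using IH[of N R a] rel less.prems(5) by blast
qed

section \<open>Back to formal combinations of admissible compositions\<close>

lemma finite_weight_le: "finite {a. weight a \<le> k}"
proof (rule finite_imageD)
  have "word ` {a. weight a \<le> k} \<subseteq> {w. set w \<subseteq> UNIV \<and> length w \<le> k}"
    by (auto simp: weight_eq_length_word)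
  then show "finite (word ` {a. weight a \<le> k})"
    by (rule finite_subset) (intro finite_lists_length_le, simp)
qed (simp add: inj_on_def word_inject)

text \<open>Independence is applied with constant polynomials on the finite set of all compositions
  of weight at most \<open>k\<close>, which contains the support of \<open>x\<close> and is closed
  under \<open>init\<close>.\<close>

lemma frag_eval_central_tail_eq_0:
  assumes "\<And>n. frag_eval (\<lambda>c. central_tail (parts c) n) x = 0"
  shows "x = 0"
proof -
  define k where "k = (\<Sum>a\<in>Poly_Mapping.keys x. weight a)"
  define S where "S = {a. weight a \<le> k}"
  have finS: "finite S" unfolding S_def by (rule finite_weight_le)
  have keys: "Poly_Mapping.keys x \<subseteq> S"
    by (auto simp: S_def k_def intro!: member_le_sum)
  have inj: "inj_on parts S" by (simp add: inj_on_def parts_inject)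
  define R where "R l = [:real_of_int (Poly_Mapping.lookup x (Acomp l)):]" for l
  have R0: "R (parts a) = 0" if "a \<in> S" for a
  proof (rule central_tail_independent[of "parts ` S" 0])
    show "0 \<notin> set b \<and> (b \<noteq> [] \<longrightarrow> hd b \<ge> 2)" if "b \<in> parts ` S" for b
      using that parts by fastforce
    show "butlast b \<in> parts ` S" if b: "b \<in> parts ` S" for b
    proof -
      obtain a where a: "b = parts a" "a \<in> S" using b by blast
      then have "init a \<in> S" using weight_init_le[of a] by (simp add: S_def)
      then show ?thesis using a by (metis image_eqI init.rep_eq)
    qed
    show "(\<Sum>b\<in>parts ` S. poly (R b) (real n) * central_tail b n) = 0" for n
      using assms[of n] frag_eval_superset[OF finS keys]
      by (simp add: sum.reindex[OF inj] R_def parts_inverse)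
  qed (use finS that in auto)
  have "Poly_Mapping.lookup x a = 0" for a
  proof (cases "a \<in> S")
    case True
    from R0[OF this] show ?thesis by (simp add: R_def parts_inverse)
  next
    case False
    then show ?thesis using keys by (auto simp: in_keys_iff)
  qed
  then show ?thesis by (simp add: poly_mapping_eqI)
qed

theorem theorem19:
  shows "{l :: bcomp \<Rightarrow>\<^sub>0 int. \<forall>n::nat. zeta_nn_lin l n = 0} = {l. delta l = 0}"
  using frag_eval_central_tail_eq_0 by (auto simp: zeta_nn_lin_eq)

end
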